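(* Let $\mathbf n$ be a sequence with gaps. The following are equivalent: (i) $\mathbf n$ has bounded quotient gaps. (ii) Every Schauder basis (of any Banach space) that is $\mathbf n$-unconditional for constant coefficients is unconditional for constant coefficients. (iii) Every Schauder basis (of any Banach space) that has the $\mathbf n$-UL property has the UL property.
   Context: Banach spaces $\mathbb X$ are separable and infinite-dimensional over $\mathbb F=\mathbb R$ or $\mathbb C$, with dual $\mathbb X^*$. A basis of $\mathbb X$ is a sequence $\mathcal B=(\mathbf e_i)_{i\in\mathbb N}\subset\mathbb X$ with closed linear span $\mathbb X$, having a (unique) sequence of biorthogonal functionals $(\mathbf e_i^* )_{i\in\mathbb N}\subset\mathbb X^*$ ($\mathbf e_k^*(\mathbf e_i)=\delta_{k,i}$), with $0<\inf_i\min\{\|\mathbf e_i\|,\|\mathbf e_i^*\|\}\le\sup_i\max\{\|\mathbf e_i\|,\|\mathbf e_i^*\|\}<\infty$. It is a Schauder basis if, in addition, $\mathbf e_i^*(x)=0$ for all $i$ implies $x=0$, and there is $\mathbf C>0$ with $\|\sum_{i=1}^m\mathbf e_i^*(x)\mathbf e_i\|\le\mathbf C\|x\|$ for all $x\in\mathbb X$, $m\in\mathbb N$. A sequence with gaps is a strictly increasing sequence $\mathbf n=(n_k)_{k\in\mathbb N}$ of positive integers (for convenience $\mathbf n=\mathbb N$ is also allowed), also regarded as a subset of $\mathbb N$. It has bounded quotient gaps if there is an integer $l\ge2$ with $n_{k+1}/n_k\le l$ for all $k$. For a finite $A\subset\mathbb N$, $\Psi_A$ is the set of families $\varepsilon=(\varepsilon_n)_{n\in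 A}\subset\mathbb F$ with $|\varepsilon_n|=1$, $\mathbf 1_{\varepsilon A}=\sum_{n\in A}\varepsilon_n\mathbf e_n$ and $\mathbf 1_A=\sum_{n\in A}\mathbf e_n$. $\mathcal B$ is $\mathbf n$-unconditional for constant coefficients if there is $\mathbf C>0$ with $\|\mathbf 1_{\varepsilon A}\|\le\mathbf C\|\mathbf 1_{\varepsilon'A}\|$ for all $A\subset\mathbb N$ with $|A|\in\mathbf n$ and all $\varepsilon,\varepsilon'\in\Psi_A$. $\mathcal B$ has the $\mathbf n$-UL property if there are $\mathbf C_1,\mathbf C_2>0$ with $\frac1{\mathbf C_1}\min_{i\in A}|a_i|\,\|\mathbf 1_A\|\le\|\sum_{i\in A}a_i\mathbf e_i\|\le\mathbf C_2\max_{i\in A}|a_i|\,\|\mathbf 1_A\|$ for all $A\subset\mathbb N$ with $|A|\in\mathbf n$ and all scalars $(a_i)_{i\in A}$. The prefix $\mathbf n$ is omitted when $\mathbf n=\mathbb N$. *)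

theory Defs
  imports "HOL-Analysis.Analysis" "HOL-Algebra.Algebraic_Closure_Type"
    "HOL-Library.Equipollence"
begin

section \<open>Banach spaces with explicit carrier\<close>

text \<open>
  A statement about every Banach space has to quantify over Banach spaces inside a formula, so a
  Banach space is a structure rather than a type: a HOL-Algebra module over the scalar field,
  together with a norm.  Scalars are the elements of a type, packaged as a HOL-Algebra ring by
  \<^const>\<open>ring_of_type_algebra\<close>; the relevant instances are \<^typ>\<open>real\<close> and \<^typ>\<open>complex\<close>.
  The record fields for ring multiplication and unit inherited by modules are irrelevant.
\<close>

record ('k, 'v) normed_module = "('k, 'v) module" +
  vnorm :: "'v \<Rightarrow> real"

locale normed_vector_space =
  module "ring_of_type_algebra :: 'k::real_normed_field ring" V
  for V :: "('k::real_normed_field, 'v) normed_module" (structure) +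
  assumes vnorm_nonneg: "x \<in> carrier V \<Longrightarrow> 0 \<le> vnorm V x"
    and vnorm_eq_zero_iff: "x \<in> carrier V \<Longrightarrow> vnorm V x = 0 \<longleftrightarrow> x = \<zero>"
    and vnorm_smult: "x \<in> carrier V \<Longrightarrow> vnorm V (a \<odot> x) = norm a * vnorm V x"
    and vnorm_triangle:
      "\<lbrakk>x \<in> carrier V; y \<in> carrier V\<rbrakk> \<Longrightarrow> vnorm V (x \<oplus> y) \<le> vnorm V x + vnorm V y"

text \<open>
  \<^locale>\<open>Metric_space\<close> demands nonnegativity and symmetry also outside the carrier, hence the
  case distinction.
\<close>

definition vdist :: "('k, 'v) normed_module \<Rightarrow> 'v \<Rightarrow> 'v \<Rightarrow> real" where
  "vdist V x y = (if x \<in> carrier V \<and> y \<in> carrier V then vnorm V (x \<ominus>\<^bsub>V\<^esub> y) else 0)"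

lemma (in normed_vector_space) vnorm_minus:
  assumes "x \<in> carrier V"
  shows "vnorm V (\<ominus> x) = vnorm V x"
proof -
  let ?R = "ring_of_type_algebra :: 'k ring"
  have "\<ominus>\<^bsub>?R\<^esub> \<one>\<^bsub>?R\<^esub> \<odot> x = \<ominus> (\<one>\<^bsub>?R\<^esub> \<odot> x)"
    using assms by (intro smult_l_minus) auto
  hence "vnorm V (\<ominus> x) = norm (\<ominus>\<^bsub>?R\<^esub> \<one>\<^bsub>?R\<^esub>) * vnorm V x"
    using assms vnorm_smult[OF assms, of "\<ominus>\<^bsub>?R\<^esub> \<one>\<^bsub>?R\<^esub>"] by simp
  also have "\<ominus>\<^bsub>?R\<^esub> \<one>\<^bsub>?R\<^esub> = - 1"
    by (rule R.minus_equality) (auto simp: ring_of_type_algebra_def)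
  finally show ?thesis by simp
qed

lemma (in normed_vector_space) Metric_space_vdist: "Metric_space (carrier V) (vdist V)"
proof
  fix x y
  show "0 \<le> vdist V x y" by (auto simp: vdist_def intro: vnorm_nonneg)
  show "vdist V x y = vdist V y x"
  proof (cases "x \<in> carrier V \<and> y \<in> carrier V")
    case True
    hence "x \<ominus> y = \<ominus> (y \<ominus> x)"
      by (simp add: M.minus_eq M.minus_add M.a_comm)
    thus ?thesis using True by (simp add: vdist_def vnorm_minus)
  qed (auto simp: vdist_def)
next
  fix x y assume *: "x \<in> carrier V" "y \<in> carrier V"
  have "x \<ominus> y = \<zero> \<longleftrightarrow> x = y"
    using * M.minus_equality[of x "\<ominus> y"] by (auto simp: M.minus_eq M.r_neg M.l_neg)
  thus "vdist V x y = 0 \<longleftrightarrow> x = y"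
    using * by (simp add: vdist_def vnorm_eq_zero_iff)
next
  fix x y z assume *: "x \<in> carrier V" "y \<in> carrier V" "z \<in> carrier V"
  have "x \<ominus> z = (x \<ominus> y) \<oplus> (y \<ominus> z)"
    using * by (simp add: M.minus_eq M.a_assoc M.r_neg1)
  thus "vdist V x z \<le> vdist V x y + vdist V y z"
    using * vnorm_triangle[of "x \<ominus> y" "y \<ominus> z"] by (simp add: vdist_def)
qed

abbreviation norm_topology :: "('k, 'v) normed_module \<Rightarrow> 'v topology" where
  "norm_topology V \<equiv> Metric_space.mtopology (carrier V) (vdist V)"

definition linear_span ::
    "('k::real_normed_field, 'v) normed_module \<Rightarrow> 'v set \<Rightarrow> 'v set" where
  "linear_span V S = (\<lambda>H. submodule H (ring_of_type_algebra :: 'k ring) V) hull S"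

definition finite_dimensional :: "('k::real_normed_field, 'v) normed_module \<Rightarrow> bool" where
  "finite_dimensional V \<longleftrightarrow>
     (\<exists>S. finite S \<and> S \<subseteq> carrier V \<and> linear_span V S = carrier V)"

text \<open>As a standing convention, Banach spaces are separable and infinite-dimensional.\<close>

locale banach_space = normed_vector_space V
  for V :: "('k::real_normed_field, 'v) normed_module" (structure) +
  assumes complete: "Metric_space.mcomplete (carrier V) (vdist V)"
    and separable: "separable_space (norm_topology V)"
    and infinite_dimensional: "\<not> finite_dimensional V"

definition dual :: "('k::real_normed_field, 'v) normed_module \<Rightarrow> ('v \<Rightarrow> 'k) set" where
  "dual V = {f \<in> extensional (carrier V).
     (\<forall>x\<in>carrier V. \<forall>y\<in>carrier V. f (x \<oplus>\<^bsub>V\<^esub> y) = f x + f y) \<and>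
     (\<forall>a. \<forall>x\<in>carrier V. f (a \<odot>\<^bsub>V\<^esub> x) = a * f x) \<and>
     (\<exists>C. \<forall>x\<in>carrier V. norm (f x) \<le> C * vnorm V x)}"

definition dual_norm :: "('k::real_normed_field, 'v) normed_module \<Rightarrow> ('v \<Rightarrow> 'k) \<Rightarrow> real" where
  "dual_norm V f = (SUP x\<in>{x \<in> carrier V. vnorm V x \<le> 1}. norm (f x))"

section \<open>Bases\<close>

text \<open>
  Basis vectors are indexed by \<^typ>\<open>nat\<close> starting from 0.  The biorthogonal functionals are
  unique because they are determined on the dense span of the basis, so it is harmless to carry
  them as a parameter and to quantify them existentially afterwards.
\<close>

definition basis_with ::
    "('k::real_normed_field, 'v) normed_module \<Rightarrow> (nat \<Rightarrow> 'v) \<Rightarrow> (nat \<Rightarrow> 'v \<Rightarrow> 'k) \<Rightarrow> bool" where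
  "basis_with V e f \<longleftrightarrow>
     range e \<subseteq> carrier V \<and>
     norm_topology V closure_of linear_span V (range e) = carrier V \<and>
     range f \<subseteq> dual V \<and>
     (\<forall>k i. f k (e i) = (if k = i then 1 else 0)) \<and>
     0 < (INF i. min (vnorm V (e i)) (dual_norm V (f i))) \<and>
     bdd_above (range (\<lambda>i. max (vnorm V (e i)) (dual_norm V (f i))))"

definition schauder_basis ::
    "('k::real_normed_field, 'v) normed_module \<Rightarrow> (nat \<Rightarrow> 'v) \<Rightarrow> bool" where
  "schauder_basis V e \<longleftrightarrow> (\<exists>f.
     basis_with V e f \<and>
     (\<forall>x\<in>carrier V. (\<forall>i. f i x = 0) \<longrightarrow> x = \<zero>\<^bsub>V\<^esub>) \<and>
     (\<exists>C>0. \<forall>x\<in>carrier V. \<forall>m. vnorm V (\<Oplus>\<^bsub>V\<^esub>i\<in>{..<m}. f i x \<odot>\<^bsub>V\<^esub> e i) \<le> C * vnorm V x))"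

section \<open>Sequences with gaps\<close>

definition gap_sequence :: "(nat \<Rightarrow> nat) \<Rightarrow> bool" where
  "gap_sequence n \<longleftrightarrow> strict_mono n \<and> (\<forall>k. 0 < n k)"

definition bounded_quotient_gaps :: "(nat \<Rightarrow> nat) \<Rightarrow> bool" where
  "bounded_quotient_gaps n \<longleftrightarrow>
     (\<exists>l::nat. 2 \<le> l \<and> (\<forall>k. real (n (Suc k)) / real (n k) \<le> real l))"

section \<open>Properties relative to a set of cardinalities\<close>

text \<open>
  Below, \<open>N\<close> is the range of a sequence with gaps; the properties without prefix are obtained
  for \<open>N = {1..}\<close>.
\<close>

definition Psi :: "nat set \<Rightarrow> (nat \<Rightarrow> 'k::real_normed_field) set" where
  "Psi A = (\<Pi>\<^sub>E i\<in>A. {z. norm z = 1})"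

definition signed_indicator ::
    "('k::real_normed_field, 'v) normed_module \<Rightarrow> (nat \<Rightarrow> 'v) \<Rightarrow> (nat \<Rightarrow> 'k) \<Rightarrow> nat set \<Rightarrow> 'v" where
  "signed_indicator V e \<epsilon> A = (\<Oplus>\<^bsub>V\<^esub>i\<in>A. \<epsilon> i \<odot>\<^bsub>V\<^esub> e i)"

definition indicator_sum ::
    "('k::real_normed_field, 'v) normed_module \<Rightarrow> (nat \<Rightarrow> 'v) \<Rightarrow> nat set \<Rightarrow> 'v" where
  "indicator_sum V e A = (\<Oplus>\<^bsub>V\<^esub>i\<in>A. e i)"

definition unconditional_const_coeffs ::
    "nat set \<Rightarrow> ('k::real_normed_field, 'v) normed_module \<Rightarrow> (nat \<Rightarrow> 'v) \<Rightarrow> bool" where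
  "unconditional_const_coeffs N V e \<longleftrightarrow>
     (\<exists>C>0. \<forall>A. finite A \<and> card A \<in> N \<longrightarrow>
        (\<forall>\<epsilon>\<in>Psi A. \<forall>\<epsilon>'\<in>Psi A.
           vnorm V (signed_indicator V e \<epsilon> A) \<le> C * vnorm V (signed_indicator V e \<epsilon>' A)))"

definition UL_property ::
    "nat set \<Rightarrow> ('k::real_normed_field, 'v) normed_module \<Rightarrow> (nat \<Rightarrow> 'v) \<Rightarrow> bool" where
  "UL_property N V e \<longleftrightarrow>
     (\<exists>C\<^sub>1>0. \<exists>C\<^sub>2>0. \<forall>A. finite A \<and> card A \<in> N \<longrightarrow>
        (\<forall>a :: nat \<Rightarrow> 'k.
           1 / C\<^sub>1 * Min ((\<lambda>i. norm (a i)) ` A) * vnorm V (indicator_sum V e A)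
             \<le> vnorm V (\<Oplus>\<^bsub>V\<^esub>i\<in>A. a i \<odot>\<^bsub>V\<^esub> e i) \<and>
           vnorm V (\<Oplus>\<^bsub>V\<^esub>i\<in>A. a i \<odot>\<^bsub>V\<^esub> e i)
             \<le> C\<^sub>2 * Max ((\<lambda>i. norm (a i)) ` A) * vnorm V (indicator_sum V e A)))"

section \<open>Size of the ambient type\<close>

text \<open>
  Formulas cannot quantify over types, so the carriers of all Banach spaces considered live in
  one type \<open>'v\<close>.  A separable Banach space has the cardinality of the continuum; hence once
  \<^typ>\<open>real\<close> injects into \<open>'v\<close>, every separable Banach space has an isometrically isomorphic copy
  with carrier in \<open>'v\<close>, and quantifying over structures on \<open>'v\<close> loses no Banach space.
\<close>

definition large_type :: "'v itself \<Rightarrow> bool" where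
  "large_type T \<longleftrightarrow> (UNIV :: real set) \<lesssim> (UNIV :: 'v set)"

end

theory Submission
  imports Defs "HOL-Library.Function_Algebras"
begin

text \<open>
  Bounded gaps transfer both properties to all cardinalities, because a finite set \<open>A\<close> with
  \<open>p \<le> |A| \<le> l p\<close> can be cut, in its natural order, into at most \<open>l\<close> consecutive pieces that
  have \<open>p\<close> elements or sit at the beginning of \<open>A\<close> inside such a piece.  For a Schauder basis the
  restriction of a finite sum to consecutive elements is bounded by the whole sum.  An estimate of
  \<open>\<parallel>\<Sum>\<^sub>D a\<^sub>i e\<^sub>i\<parallel>\<close> by \<open>\<parallel>\<Sum>\<^sub>D b\<^sub>i e\<^sub>i\<parallel>\<close> on sets \<open>D\<close> with \<open>p\<close> elements therefore extends to \<open>A\<close>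
  (\<open>sum_norm_le_of_pieces\<close>).  Signs and the two halves of the UL property are instances of such
  an estimate with \<open>|a\<^sub>i| \<le> |b\<^sub>i|\<close>; this last condition makes \<open>p = 1\<close> admissible, which takes care of
  the sets smaller than \<open>n 0\<close>.

  If the gaps are unbounded, a single space refutes both implications, since the UL property
  implies unconditionality for constant coefficients.  Take the closure of the finitely supported
  sequences under the supremum of the \<open>\<ell>\<^sub>2\<close> norm and the seminorms
  \<open>|x\<^sub>0 + \<dots> + x\<^sub>r\<^sub>-\<^sub>1| / \<surd>n\<^sub>k\<close> with \<open>r\<^sup>2 \<le> n\<^sub>k n\<^sub>k\<^sub>+\<^sub>1\<close>.  On a set of cardinality
  \<open>n\<^sub>j\<close> the additional seminorms never exceed the \<open>\<ell>\<^sub>2\<close> bound \<open>max |a\<^sub>i| \<surd>n\<^sub>j\<close>: for \<open>j \<le> k\<close> because only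
  \<open>n\<^sub>j \<le> \<surd>n\<^sub>j \<surd>n\<^sub>k\<close> coefficients are available, and for \<open>j > k\<close> because
  \<open>r \<le> \<surd>n\<^sub>k \<surd>n\<^sub>j\<close>.  Hence the UL property holds on these sets with both constants \<open>1\<close>
  (\<open>UL_property_range\<close>).  On the first \<open>m \<approx> \<surd>(n\<^sub>k n\<^sub>k\<^sub>+\<^sub>1)\<close> vectors, however, alternating signs give
  norm \<open>\<surd>m\<close> while constant signs give at least \<open>m / \<surd>n\<^sub>k\<close>, and the quotient
  \<open>\<surd>(m / n\<^sub>k)\<close> is about \<open>(n\<^sub>k\<^sub>+\<^sub>1 / n\<^sub>k)\<^sup>1\<^sup>/\<^sup>4\<close> (\<open>bounded_gaps_if_unconditional\<close>).

  The seminorms are stable under passing to initial parts of a sequence, which bounds the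
  partial sum projections of the coordinate vectors.  The Banach space is therefore built for an
  arbitrary family of seminorms of this kind (\<open>coordinate_seminorms\<close>) and copied into the given type along an
  injection, which exists because a second countable Hausdorff space of scalars has at most continuum
  many points, and so has the set of its sequences.
\<close>

section \<open>Splitting a set into consecutive pieces\<close>

lemma (in normed_vector_space) carrier_scalars [simp]:
  "carrier (ring_of_type_algebra :: 'k ring) = UNIV"
  by (simp add: ring_of_type_algebra_def)

text \<open>
  Moving the cut by one changes the cardinality by at most one, so every intermediate value occurs.
\<close>

lemma ex_initial_segment_card:
  fixes A :: "nat set"
  assumes "finite A" "p \<le> card A"
  shows "\<exists>q. card (A \<inter> {..<q}) = p"
proof -
  have "\<forall>i<Suc (Max A). \<bar>int (card (A \<inter> {..<i + 1})) - int (card (A \<inter> {..<i}))\<bar> \<le> 1"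
    using assms by (auto simp: lessThan_Suc Int_insert_right card_insert_if)
  moreover have "A \<inter> {..<Suc (Max A)} = A" using assms by (auto simp: less_Suc_eq_le)
  hence "int p \<le> int (card (A \<inter> {..<Suc (Max A)}))" using assms by simp
  ultimately have "\<exists>q\<le>Suc (Max A). int (card (A \<inter> {..<q})) = int p"
    by (intro nat0_intermed_int_val) auto
  thus ?thesis by auto
qed

definition (in normed_vector_space) sum_norm :: "(nat \<Rightarrow> 'v) \<Rightarrow> (nat \<Rightarrow> 'k) \<Rightarrow> nat set \<Rightarrow> real" where
  "sum_norm e a A = vnorm V (\<Oplus>i\<in>A. a i \<odot> e i)"

context normed_vector_space
begin

context
  fixes e :: "nat \<Rightarrow> 'v"
  assumes e: "range e \<subseteq> carrier V"
begin

lemma e_carrier [simp]: "e i \<in> carrier V"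
  using e by auto

lemma finsum_carrier [simp]: "(\<Oplus>i\<in>A. a i \<odot> e i) \<in> carrier V"
  by (intro M.finsum_closed) auto

lemma sum_norm_nonneg: "0 \<le> sum_norm e a A"
  by (simp add: sum_norm_def vnorm_nonneg)

lemma sum_norm_empty [simp]: "sum_norm e a {} = 0"
  by (simp add: sum_norm_def vnorm_eq_zero_iff)

lemma sum_norm_singleton: "sum_norm e a {i} = norm (a i) * vnorm V (e i)"
  by (simp add: sum_norm_def vnorm_smult)

lemma sum_norm_Un_disjoint_le:
  assumes "finite D" "finite E" "D \<inter> E = {}"
  shows "sum_norm e a (D \<union> E) \<le> sum_norm e a D + sum_norm e a E"
  unfolding sum_norm_def using assms
  by (subst M.finsum_Un_disjoint) (auto intro!: vnorm_triangle)

lemma sum_norm_diff_le: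
  assumes "finite A" "D \<subseteq> A"
  shows "sum_norm e a (A - D) \<le> sum_norm e a A + sum_norm e a D"
proof -
  define x where "x = (\<Oplus>i\<in>A - D. a i \<odot> e i)"
  define y where "y = (\<Oplus>i\<in>D. a i \<odot> e i)"
  have [simp]: "x \<in> carrier V" "y \<in> carrier V" by (simp_all add: x_def y_def)
  have "(\<Oplus>i\<in>(A - D) \<union> D. a i \<odot> e i) = x \<oplus> y"
    using assms unfolding x_def y_def
    by (intro M.finsum_Un_disjoint) (auto intro: finite_subset)
  hence xy: "(\<Oplus>i\<in>A. a i \<odot> e i) = x \<oplus> y" using assms by (simp add: Un_absorb2)
  have "x = (x \<oplus> y) \<oplus> \<ominus> y" by (simp add: M.a_assoc M.r_neg)
  hence "vnorm V x \<le> vnorm V (x \<oplus> y) + vnorm V (\<ominus> y)"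
    using vnorm_triangle[of "x \<oplus> y" "\<ominus> y"] by simp
  thus ?thesis using xy by (simp add: sum_norm_def vnorm_minus flip: x_def y_def)
qed

text \<open>
  Initial sections \<open>E\<close> of \<open>A\<close> are treated by induction on the number \<open>j\<close> of pieces needed.  If \<open>E\<close>
  has at least \<open>p\<close> elements, its last \<open>p\<close> elements form a piece to which the hypothesis applies, and
  what remains is an initial section needing one piece less.  If it has fewer, it is itself an initial
  section of the first \<open>p\<close> elements of \<open>A\<close>; this is where \<open>p \<le> card A\<close> enters.  Passing from \<open>A\<close> to
  consecutive elements costs at most \<open>K\<close> for cutting off at the right and \<open>1 + K\<close> at the left.
\<close>

lemma sum_norm_le_of_pieces:
  assumes init: "\<And>a A m. finite A \<Longrightarrow> sum_norm e a (A \<inter> {..<m}) \<le> K * sum_norm e a A"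
    and K: "0 \<le> K" and C: "0 \<le> C" and A: "finite A"
    and p: "0 < p" "p \<le> card A" "card A \<le> l * p"
    and pieces: "\<And>D. D \<subseteq> A \<Longrightarrow> card D = p \<Longrightarrow> sum_norm e a D \<le> C * sum_norm e b D"
  shows "sum_norm e a A \<le> real l * (K * (1 + K) * C) * sum_norm e b A"
proof -
  define M where "M = K * (1 + K) * C"
  have M: "0 \<le> M" using K C by (simp add: M_def)
  have tail: "sum_norm e c (D \<inter> {q..}) \<le> (1 + K) * sum_norm e c D" if "finite D" for c D q
    using sum_norm_diff_le[OF that, of "D \<inter> {..<q}" c] init[OF that, of c q]
    by (auto simp: Diff_Int_distrib algebra_simps Diff_Int Int_Un_distrib
        simp flip: Compl_lessThan Diff_eq)
  have "sum_norm e a (A \<inter> {..<m}) \<le> real j * M * sum_norm e b A"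
    if "card (A \<inter> {..<m}) \<le> j * p" for j m
    using that
  proof (induction j arbitrary: m)
    case 0
    hence "A \<inter> {..<m} = {}" using A by auto
    thus ?case by (simp only: sum_norm_empty)
  next
    case (Suc j)
    define E where "E = A \<inter> {..<m}"
    have fE: "finite E" using A by (simp add: E_def)
    show ?case
    proof (cases "p \<le> card E")
      case True
      \<comment> \<open>Cut off the last \<open>p\<close> elements of \<open>E\<close>.\<close>
      obtain q where q: "card (E \<inter> {..<q}) = card E - p"
        using ex_initial_segment_card[OF fE] by (metis diff_le_self)
      define D where "D = E \<inter> {q..}"
      have E: "E = (E \<inter> {..<q}) \<union> D" "(E \<inter> {..<q}) \<inter> D = {}" by (auto simp: D_def)
      have "card E = card (E \<inter> {..<q}) + card D"
        using E fE by (metis card_Un_disjoint finite_Un)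
      hence cD: "card D = p" using q True by linarith
      have init_eq: "E \<inter> {..<q} = A \<inter> {..<min m q}" by (auto simp: E_def)
      have D_eq: "D = (A \<inter> {..<m}) \<inter> {q..}" by (simp add: D_def E_def)
      \<comment> \<open>The piece \<open>D\<close> arises from \<open>A\<close> by cutting first at \<open>m\<close>, then at \<open>q\<close>.\<close>
      have "sum_norm e b D \<le> (1 + K) * (K * sum_norm e b A)"
        unfolding D_eq using tail[of "A \<inter> {..<m}" b q] init[OF A, of b m] A K
        by (meson finite_Int add_nonneg_nonneg mult_left_mono order_trans zero_le_one)
      hence "C * sum_norm e b D \<le> C * ((1 + K) * (K * sum_norm e b A))"
        using C by (rule mult_left_mono)
      moreover have "sum_norm e a D \<le> C * sum_norm e b D"
        using cD by (intro pieces) (auto simp: D_def E_def)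
      ultimately have "sum_norm e a D \<le> M * sum_norm e b A"
        by (simp add: M_def mult_ac)
      moreover have "sum_norm e a (A \<inter> {..<min m q}) \<le> real j * M * sum_norm e b A"
        using Suc.prems q by (intro Suc.IH) (simp flip: init_eq E_def)
      moreover have "sum_norm e a E \<le> sum_norm e a (E \<inter> {..<q}) + sum_norm e a D"
        using sum_norm_Un_disjoint_le[of "E \<inter> {..<q}" D a] E fE by (metis finite_Un)
      ultimately show ?thesis
        by (simp add: init_eq algebra_simps flip: E_def)
    next
      case False
      \<comment> \<open>\<open>E\<close> is an initial piece of the first \<open>p\<close> elements of \<open>A\<close>.\<close>
      obtain q where q: "card (A \<inter> {..<q}) = p"
        using ex_initial_segment_card[OF A] p by blast
      have "m \<le> q"
      proof (rule ccontr)
        assume "\<not> m \<le> q"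
        hence "card (A \<inter> {..<q}) \<le> card E"
          using A by (intro card_mono) (auto simp: E_def)
        thus False using q False by simp
      qed
      hence E: "E = (A \<inter> {..<q}) \<inter> {..<m}" by (auto simp: E_def)
      have "sum_norm e a E \<le> K * sum_norm e a (A \<inter> {..<q})"
        unfolding E using A by (intro init) auto
      also have "\<dots> \<le> K * (C * sum_norm e b (A \<inter> {..<q}))"
        using q K by (intro mult_left_mono pieces) auto
      also have "\<dots> \<le> K * (C * (K * sum_norm e b A))"
        using A K C by (intro mult_left_mono init) auto
      also have "\<dots> \<le> M * sum_norm e b A"
        using K C sum_norm_nonneg[of b A] by (simp add: M_def algebra_simps)
      also have "\<dots> \<le> real (Suc j) * M * sum_norm e b A"
        using M sum_norm_nonneg[of b A] by (simp add: algebra_simps)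
      finally show ?thesis by (simp add: E_def)
    qed
  qed
  moreover have "A \<inter> {..<Suc (Max A)} = A" using A by (auto simp: less_Suc_eq_le)
  ultimately show ?thesis using p unfolding M_def by (metis)
qed

end

end

text \<open>
  The bounded projections of a Schauder basis keep the first \<open>m\<close> coordinates, and on a finite sum the
  biorthogonal functionals return the coefficients.
\<close>

lemma schauder_basis_initial_sums_bounded:
  fixes V :: "('k::real_normed_field, 'v) normed_module" (structure)
  assumes "normed_vector_space V" "schauder_basis V e"
  obtains K where "0 < K"
    and "\<And>a A m. finite A \<Longrightarrow>
      vnorm V (\<Oplus>i\<in>A \<inter> {..<m}. a i \<odot> e i) \<le> K * vnorm V (\<Oplus>i\<in>A. a i \<odot> e i)"
proof -
  interpret normed_vector_space V by fact
  from assms obtain f K where b: "basis_with V e f" and K: "K > 0"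
    and proj: "\<And>x m. x \<in> carrier V \<Longrightarrow> vnorm V (\<Oplus>i\<in>{..<m}. f i x \<odot> e i) \<le> K * vnorm V x"
    unfolding schauder_basis_def by blast
  have e [simp]: "e i \<in> carrier V" for i using b by (auto simp: basis_with_def)
  have fe: "f k (e i) = (if k = i then 1 else 0)" for k i using b by (auto simp: basis_with_def)
  have dual: "f k \<in> dual V" for k using b by (auto simp: basis_with_def)
  have f: "f k (x \<oplus> y) = f k x + f k y" if "x \<in> carrier V" "y \<in> carrier V" for k x y
    using dual[of k] that by (auto simp: dual_def)
  have fs: "f k (c \<odot> x) = c * f k x" if "x \<in> carrier V" for k c x
    using dual[of k] that by (auto simp: dual_def)
  have f0: "f k \<zero> = 0" for k using f[of "\<zero>" "\<zero>" k] by simp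
  have fsum: "f k (\<Oplus>i\<in>A. a i \<odot> e i) = (if k \<in> A then a k else 0)" if "finite A" for a A k
    using that
  proof induction
    case (insert j A)
    have "(\<Oplus>i\<in>insert j A. a i \<odot> e i) = a j \<odot> e j \<oplus> (\<Oplus>i\<in>A. a i \<odot> e i)"
      using insert by (intro M.finsum_insert) auto
    moreover have "(\<Oplus>i\<in>A. a i \<odot> e i) \<in> carrier V" by (intro M.finsum_closed) auto
    ultimately show ?case using insert by (auto simp: f fs fe)
  qed (simp add: f0)
  have "vnorm V (\<Oplus>i\<in>A \<inter> {..<m}. a i \<odot> e i) \<le> K * vnorm V (\<Oplus>i\<in>A. a i \<odot> e i)"
    if A: "finite A" for a A m
  proof -
    define x where "x = (\<Oplus>i\<in>A. a i \<odot> e i)"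
    have x: "x \<in> carrier V" unfolding x_def by (intro M.finsum_closed) auto
    have "(\<Oplus>i\<in>{..<m}. f i x \<odot> e i) = (\<Oplus>i\<in>A \<inter> {..<m}. a i \<odot> e i)"
    proof (rule M.add.finprod_mono_neutral_cong_right)
      show "\<And>i. i \<in> A \<inter> {..<m} \<Longrightarrow> f i x \<odot> e i = a i \<odot> e i"
        using A by (simp add: x_def fsum)
      show "f i x \<odot> e i = \<zero>" if "i \<in> {..<m} - A \<inter> {..<m}" for i
        using A that smult_l_null[OF e] by (auto simp: x_def fsum ring_of_type_algebra_def)
    qed auto
    with proj[OF x, of m] show ?thesis by (simp add: x_def)
  qed
  with K show ?thesis by (rule that)
qed

text \<open>
  The value \<open>p = 1\<close> serves the cardinalities below \<open>n 0\<close>; for the others \<open>p\<close> is the last term of the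
  sequence that does not exceed \<open>m\<close>.
\<close>

lemma bounded_quotient_gaps_approximate:
  assumes "gap_sequence n" "bounded_quotient_gaps n"
  obtains L where "\<And>m. 0 < m \<Longrightarrow> \<exists>p\<in>insert 1 (range n). p \<le> m \<and> m \<le> L * p"
proof -
  from assms obtain l where l: "\<And>k. real (n (Suc k)) / real (n k) \<le> real l"
    unfolding bounded_quotient_gaps_def by blast
  have n: "strict_mono n" "\<And>k. 0 < n k" using assms by (auto simp: gap_sequence_def)
  have "\<exists>p\<in>insert 1 (range n). p \<le> m \<and> m \<le> max l (n 0) * p" if "0 < m" for m
  proof (cases "m < n 0")
    case True
    thus ?thesis using that by (intro bexI[of _ 1]) auto
  next
    case False
    have "m < n (Suc m)" using strict_mono_imp_increasing[OF n(1), of "Suc m"] by simp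
    define k where "k = (LEAST k. m < n k)"
    have k: "m < n k" unfolding k_def by (rule LeastI) fact
    then obtain j where j: "k = Suc j" using False by (cases k) auto
    have "\<not> m < n j" using j not_less_Least[of j "\<lambda>k. m < n k"] by (simp add: k_def)
    moreover have "real (n (Suc j)) \<le> real (l * n j)"
      using l[of j] n(2)[of j] by (simp add: field_simps)
    hence "n (Suc j) \<le> l * n j" by (simp only: of_nat_le_iff)
    hence "m \<le> l * n j" using k j by simp
    hence "m \<le> max l (n 0) * n j" by (meson le_trans max.cobounded1 mult_le_mono1)
    ultimately show ?thesis by (intro bexI[of _ "n j"]) auto
  qed
  thus ?thesis by (rule that)
qed

text \<open>
  The condition \<open>|a\<^sub>i| \<le> |b\<^sub>i|\<close> is exactly the comparison on singletons, so that pieces of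
  cardinality \<open>1\<close> can be used alongside those with cardinality in the range of \<open>n\<close>.
\<close>

lemma comparison_extends_to_all_cardinalities:
  fixes V :: "('k::real_normed_field, 'v) normed_module" (structure)
  assumes "normed_vector_space V" "schauder_basis V e"
    and "gap_sequence n" "bounded_quotient_gaps n"
  shows "\<exists>M>0. \<forall>C A a b. 1 \<le> C \<and> finite A \<and> A \<noteq> {} \<and> (\<forall>i\<in>A. norm (a i) \<le> norm (b i)) \<and>
      (\<forall>D\<subseteq>A. card D \<in> range n \<longrightarrow>
        vnorm V (\<Oplus>i\<in>D. a i \<odot> e i) \<le> C * vnorm V (\<Oplus>i\<in>D. b i \<odot> e i)) \<longrightarrow>
      vnorm V (\<Oplus>i\<in>A. a i \<odot> e i) \<le> M * C * vnorm V (\<Oplus>i\<in>A. b i \<odot> e i)"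
proof -
  interpret normed_vector_space V by fact
  from assms(2) have e: "range e \<subseteq> carrier V" by (auto simp: schauder_basis_def basis_with_def)
  note sn = sum_norm_def
  obtain K where K: "0 < K"
    and init: "\<And>a A m. finite A \<Longrightarrow> sum_norm e a (A \<inter> {..<m}) \<le> K * sum_norm e a A"
    using schauder_basis_initial_sums_bounded[OF assms(1,2)] unfolding sn by metis
  obtain L where L: "\<And>m. 0 < m \<Longrightarrow> \<exists>p\<in>insert 1 (range n). p \<le> m \<and> m \<le> L * p"
    using bounded_quotient_gaps_approximate[OF assms(3,4)] by metis
  have "sum_norm e a A \<le> ((real L + 1) * (K * (1 + K))) * C * sum_norm e b A"
    if C: "1 \<le> C" and A: "finite A" "A \<noteq> {}" and ab: "\<And>i. i \<in> A \<Longrightarrow> norm (a i) \<le> norm (b i)"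
    and cmp: "\<And>D. D \<subseteq> A \<Longrightarrow> card D \<in> range n \<Longrightarrow> sum_norm e a D \<le> C * sum_norm e b D"
    for C A a b
  proof -
    obtain p where p: "p \<in> insert 1 (range n)" "p \<le> card A" "card A \<le> L * p"
      using L[of "card A"] A by (meson card_gt_0_iff)
    have p0: "0 < p" using p(1) assms(3) by (auto simp: gap_sequence_def)
    have piece: "sum_norm e a D \<le> C * sum_norm e b D" if D: "D \<subseteq> A" "card D = p" for D
    proof (cases "p = 1")
      case True
      then obtain i where i: "D = {i}" using D by (auto simp: card_1_singleton_iff)
      have "sum_norm e a D \<le> 1 * sum_norm e b D"
        using ab[of i] D e unfolding i
        by (auto simp: sum_norm_singleton[OF e] intro!: mult_right_mono vnorm_nonneg)
      also have "\<dots> \<le> C * sum_norm e b D"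
        using C sum_norm_nonneg[OF e] by (intro mult_right_mono) auto
      finally show ?thesis .
    next
      case False
      thus ?thesis using p(1) D by (intro cmp) auto
    qed
    have "sum_norm e a A \<le> real L * (K * (1 + K) * C) * sum_norm e b A"
      using K C by (intro sum_norm_le_of_pieces[OF e init _ _ A(1) p0 p(2,3) piece]) auto
    also have "\<dots> \<le> (real L + 1) * (K * (1 + K) * C) * sum_norm e b A"
      using K C sum_norm_nonneg[OF e] by (intro mult_right_mono) auto
    finally show ?thesis by (simp add: mult_ac)
  qed
  thus ?thesis unfolding sn using K
    by (intro exI[of _ "(real L + 1) * (K * (1 + K))"] conjI mult_pos_pos allI impI) auto
qed

text \<open>
  The preceding comparison with \<open>a = \<epsilon>\<close> and \<open>b = \<epsilon>'\<close>.  Restricting a family of signs to a subset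
  leaves a family of signs.
\<close>

lemma unconditional_const_coeffs_if_bounded_gaps:
  fixes V :: "('k::real_normed_field, 'v) normed_module" (structure)
  assumes V: "normed_vector_space V" "schauder_basis V e"
    and n: "gap_sequence n" "bounded_quotient_gaps n"
    and ucc: "unconditional_const_coeffs (range n) V e"
  shows "unconditional_const_coeffs {1..} V e"
proof -
  interpret normed_vector_space V by fact
  from V(2) have e [simp]: "e i \<in> carrier V" for i by (auto simp: schauder_basis_def basis_with_def)
  obtain M where M: "0 < M"
    and ext: "\<forall>C A a b. 1 \<le> C \<and> finite A \<and> A \<noteq> {} \<and> (\<forall>i\<in>A. norm (a i) \<le> norm (b i)) \<and>
      (\<forall>D\<subseteq>A. card D \<in> range n \<longrightarrow>
        vnorm V (\<Oplus>i\<in>D. a i \<odot> e i) \<le> C * vnorm V (\<Oplus>i\<in>D. b i \<odot> e i)) \<longrightarrow>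
      vnorm V (\<Oplus>i\<in>A. a i \<odot> e i) \<le> M * C * vnorm V (\<Oplus>i\<in>A. b i \<odot> e i)"
    using comparison_extends_to_all_cardinalities[OF V n] by blast
  obtain C where C: "0 < C"
    and ucc': "\<And>A \<epsilon> \<epsilon>'. \<lbrakk>finite A; card A \<in> range n; \<epsilon> \<in> Psi A; \<epsilon>' \<in> Psi A\<rbrakk> \<Longrightarrow>
        vnorm V (signed_indicator V e \<epsilon> A) \<le> C * vnorm V (signed_indicator V e \<epsilon>' A)"
    using ucc unfolding unconditional_const_coeffs_def by blast
  have restr: "signed_indicator V e (restrict \<epsilon> D) D = (\<Oplus>i\<in>D. \<epsilon> i \<odot> e i)" for \<epsilon> D
    unfolding signed_indicator_def by (intro M.finsum_cong') auto
  have "vnorm V (signed_indicator V e \<epsilon> A) \<le> M * (C + 1) * vnorm V (signed_indicator V e \<epsilon>' A)"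
    if A: "finite A" "card A \<in> {1..}" "\<epsilon> \<in> Psi A" "\<epsilon>' \<in> Psi A" for A \<epsilon> \<epsilon>'
    unfolding signed_indicator_def
  proof (rule ext[rule_format], intro conjI ballI allI impI)
    show "A \<noteq> {}" using A by auto
    show "norm (\<epsilon> i) \<le> norm (\<epsilon>' i)" if "i \<in> A" for i
      using A that by (auto simp: Psi_def PiE_iff)
  next
    fix D assume D: "D \<subseteq> A" "card D \<in> range n"
    have "vnorm V (\<Oplus>i\<in>D. \<epsilon> i \<odot> e i) \<le> C * vnorm V (\<Oplus>i\<in>D. \<epsilon>' i \<odot> e i)"
      unfolding restr[symmetric] using D A
      by (intro ucc') (auto simp: Psi_def PiE_iff intro: finite_subset)
    also have "\<dots> \<le> (C + 1) * vnorm V (\<Oplus>i\<in>D. \<epsilon>' i \<odot> e i)"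
      by (intro mult_right_mono vnorm_nonneg M.finsum_closed) auto
    finally show "vnorm V (\<Oplus>i\<in>D. \<epsilon> i \<odot> e i) \<le> (C + 1) * vnorm V (\<Oplus>i\<in>D. \<epsilon>' i \<odot> e i)" .
  qed (use C A in auto)
  moreover have "0 < M * (C + 1)" using M C by simp
  ultimately show ?thesis unfolding unconditional_const_coeffs_def by blast
qed

text \<open>
  The lower estimate compares the constant sequence \<open>min |a\<^sub>i|\<close> with \<open>a\<close>, the upper one \<open>a\<close> with the
  constant sequence \<open>max |a\<^sub>i|\<close>.  On a subset the minimum can only grow and the maximum only shrink,
  so the hypothesis on small sets gives the comparison with the extremal values over \<open>A\<close>.
\<close>

lemma UL_property_if_bounded_gaps:
  fixes V :: "('k::real_normed_field, 'v) normed_module" (structure)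
  assumes V: "normed_vector_space V" "schauder_basis V e"
    and n: "gap_sequence n" "bounded_quotient_gaps n"
    and UL: "UL_property (range n) V e"
  shows "UL_property {1..} V e"
proof -
  interpret normed_vector_space V by fact
  from V(2) have e [simp]: "e i \<in> carrier V" for i by (auto simp: schauder_basis_def basis_with_def)
  have sum [simp]: "(\<Oplus>i\<in>D. a i \<odot> e i) \<in> carrier V" "(\<Oplus>i\<in>D. e i) \<in> carrier V" for D a
    by (intro M.finsum_closed; auto)+
  obtain M where M: "0 < M"
    and ext: "\<forall>C A a b. 1 \<le> C \<and> finite A \<and> A \<noteq> {} \<and> (\<forall>i\<in>A. norm (a i) \<le> norm (b i)) \<and>
      (\<forall>D\<subseteq>A. card D \<in> range n \<longrightarrow>
        vnorm V (\<Oplus>i\<in>D. a i \<odot> e i) \<le> C * vnorm V (\<Oplus>i\<in>D. b i \<odot> e i)) \<longrightarrow>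
      vnorm V (\<Oplus>i\<in>A. a i \<odot> e i) \<le> M * C * vnorm V (\<Oplus>i\<in>A. b i \<odot> e i)"
    using comparison_extends_to_all_cardinalities[OF V n] by blast
  obtain C1 C2 where C: "0 < C1" "0 < C2"
    and UL': "\<And>A a. \<lbrakk>finite A; card A \<in> range n\<rbrakk> \<Longrightarrow>
           1 / C1 * Min ((\<lambda>i. norm (a i)) ` A) * vnorm V (indicator_sum V e A)
             \<le> vnorm V (\<Oplus>i\<in>A. a i \<odot> e i) \<and>
           vnorm V (\<Oplus>i\<in>A. a i \<odot> e i)
             \<le> C2 * Max ((\<lambda>i. norm (a i)) ` A) * vnorm V (indicator_sum V e A)"
    using UL unfolding UL_property_def by blast
  have const: "vnorm V (\<Oplus>i\<in>D. of_real t \<odot> e i) = t * vnorm V (indicator_sum V e D)"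
    if "finite D" "0 \<le> t" for D t
  proof -
    have "(\<Oplus>i\<in>D. of_real t \<odot> e i) = of_real t \<odot> (\<Oplus>i\<in>D. e i)"
      using that(1)
    proof induction
      case empty
      show ?case using smult_r_null[of "of_real t"] by simp
    next
      case (insert j D)
      have "(\<Oplus>i\<in>insert j D. of_real t \<odot> e i) = of_real t \<odot> e j \<oplus> (\<Oplus>i\<in>D. of_real t \<odot> e i)"
        "(\<Oplus>i\<in>insert j D. e i) = e j \<oplus> (\<Oplus>i\<in>D. e i)"
        using insert by (auto intro!: M.finsum_insert)
      thus ?case using insert.IH by (simp only: smult_r_distr e sum carrier_scalars UNIV_I)
    qed
    thus ?thesis using that by (simp add: indicator_sum_def vnorm_smult)
  qed
  have nz: "D \<noteq> {}" if "card D \<in> range n" for D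
    using that n(1) unfolding gap_sequence_def by (metis card.empty imageE less_irrefl)
  have "1 / (M * (C1 + 1)) * Min ((\<lambda>i. norm (a i)) ` A) * vnorm V (indicator_sum V e A)
          \<le> vnorm V (\<Oplus>i\<in>A. a i \<odot> e i) \<and>
        vnorm V (\<Oplus>i\<in>A. a i \<odot> e i)
          \<le> M * (C2 + 1) * Max ((\<lambda>i. norm (a i)) ` A) * vnorm V (indicator_sum V e A)"
    if A: "finite A" "card A \<in> {1..}" for A and a :: "nat \<Rightarrow> 'k"
  proof
    have Ane: "A \<noteq> {}" using A by auto
    define lo where "lo = Min ((\<lambda>i. norm (a i)) ` A)"
    define hi where "hi = Max ((\<lambda>i. norm (a i)) ` A)"
    have lo: "0 \<le> lo" unfolding lo_def using A Ane by (subst Min_ge_iff) auto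
    have hi: "0 \<le> hi" unfolding hi_def using A Ane by (subst Max_ge_iff) auto
    have fD: "finite D" if "D \<subseteq> A" for D using that A finite_subset by blast
    have "vnorm V (\<Oplus>i\<in>A. of_real lo \<odot> e i) \<le> M * (C1 + 1) * vnorm V (\<Oplus>i\<in>A. a i \<odot> e i)"
    proof (rule ext[rule_format], intro conjI ballI allI impI)
      fix D assume D: "D \<subseteq> A" "card D \<in> range n"
      have "lo \<le> Min ((\<lambda>i. norm (a i)) ` D)"
        unfolding lo_def using D A nz[OF D(2)] by (intro Min_antimono) auto
      hence "1 / C1 * lo * vnorm V (indicator_sum V e D)
          \<le> 1 / C1 * Min ((\<lambda>i. norm (a i)) ` D) * vnorm V (indicator_sum V e D)"
        using C by (intro mult_right_mono mult_left_mono vnorm_nonneg) (auto simp: indicator_sum_def)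
      also have "\<dots> \<le> vnorm V (\<Oplus>i\<in>D. a i \<odot> e i)"
        using UL'[OF fD] D by blast
      finally have "lo * vnorm V (indicator_sum V e D) \<le> C1 * vnorm V (\<Oplus>i\<in>D. a i \<odot> e i)"
        using C by (simp add: field_simps)
      also have "\<dots> \<le> (C1 + 1) * vnorm V (\<Oplus>i\<in>D. a i \<odot> e i)"
        by (intro mult_right_mono vnorm_nonneg) auto
      finally show "vnorm V (\<Oplus>i\<in>D. of_real lo \<odot> e i) \<le> (C1 + 1) * vnorm V (\<Oplus>i\<in>D. a i \<odot> e i)"
        using const[OF fD[OF D(1)] lo] by simp
    qed (use A Ane lo C in \<open>auto simp: lo_def\<close>)
    hence "lo * vnorm V (indicator_sum V e A) \<le> (M * (C1 + 1)) * vnorm V (\<Oplus>i\<in>A. a i \<odot> e i)"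
      using const[OF A(1) lo] by simp
    moreover have "0 < M * (C1 + 1)" using M C by simp
    ultimately show "1 / (M * (C1 + 1)) * Min ((\<lambda>i. norm (a i)) ` A) * vnorm V (indicator_sum V e A)
          \<le> vnorm V (\<Oplus>i\<in>A. a i \<odot> e i)"
      unfolding lo_def[symmetric] times_divide_eq_left mult_1 by (subst pos_divide_le_eq) (simp_all only: mult_ac)
    have "vnorm V (\<Oplus>i\<in>A. a i \<odot> e i) \<le> M * (C2 + 1) * vnorm V (\<Oplus>i\<in>A. of_real hi \<odot> e i)"
    proof (rule ext[rule_format], intro conjI ballI allI impI)
      fix D assume D: "D \<subseteq> A" "card D \<in> range n"
      have nn: "0 \<le> vnorm V (indicator_sum V e D)"
        by (auto simp: indicator_sum_def intro: vnorm_nonneg)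
      have "Max ((\<lambda>i. norm (a i)) ` D) \<le> hi"
        unfolding hi_def using D A nz[OF D(2)] by (intro Max_mono) auto
      hence "C2 * Max ((\<lambda>i. norm (a i)) ` D) * vnorm V (indicator_sum V e D)
          \<le> C2 * hi * vnorm V (indicator_sum V e D)"
        using C nn by (intro mult_right_mono mult_left_mono) auto
      moreover have "\<dots> \<le> (C2 + 1) * hi * vnorm V (indicator_sum V e D)"
        using hi nn by (intro mult_right_mono) auto
      ultimately show "vnorm V (\<Oplus>i\<in>D. a i \<odot> e i) \<le> (C2 + 1) * vnorm V (\<Oplus>i\<in>D. of_real hi \<odot> e i)"
        using const[OF fD[OF D(1)] hi] UL'[OF fD[OF D(1)] D(2), of a] by (simp add: mult.assoc)
    qed (use A Ane hi C in \<open>auto simp: hi_def\<close>)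
    thus "vnorm V (\<Oplus>i\<in>A. a i \<odot> e i)
          \<le> M * (C2 + 1) * Max ((\<lambda>i. norm (a i)) ` A) * vnorm V (indicator_sum V e A)"
      using const[OF A(1) hi] by (simp add: mult.assoc flip: hi_def)
  qed
  moreover have "0 < M * (C1 + 1)" "0 < M * (C2 + 1)" using M C by simp_all
  ultimately show ?thesis unfolding UL_property_def by blast
qed

section \<open>The UL property controls signs\<close>

text \<open>
  Signs have modulus one, so both signed sums are comparable to the unsigned one.
\<close>

lemma UL_imp_unconditional:
  fixes V :: "('k::real_normed_field, 'v) normed_module"
  assumes "UL_property N V e" "0 \<notin> N"
  shows "unconditional_const_coeffs N V e"
proof -
  obtain C1 C2 where C: "0 < C1" "0 < C2"
    and UL: "\<And>A a. \<lbrakk>finite A; card A \<in> N\<rbrakk> \<Longrightarrow>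
           1 / C1 * Min ((\<lambda>i. norm (a i)) ` A) * vnorm V (indicator_sum V e A)
             \<le> vnorm V (\<Oplus>\<^bsub>V\<^esub>i\<in>A. a i \<odot>\<^bsub>V\<^esub> e i) \<and>
           vnorm V (\<Oplus>\<^bsub>V\<^esub>i\<in>A. a i \<odot>\<^bsub>V\<^esub> e i)
             \<le> C2 * Max ((\<lambda>i. norm (a i)) ` A) * vnorm V (indicator_sum V e A)"
    using assms(1) unfolding UL_property_def by blast
  have "vnorm V (signed_indicator V e \<epsilon> A) \<le> (C2 * C1) * vnorm V (signed_indicator V e \<epsilon>' A)"
    if A: "finite A" "card A \<in> N" "\<epsilon> \<in> Psi A" "\<epsilon>' \<in> Psi A" for A \<epsilon> \<epsilon>'
  proof -
    have "A \<noteq> {}" using A assms(2) by auto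
    hence im: "(\<lambda>i. norm (\<epsilon> i)) ` A = {1}" "(\<lambda>i. norm (\<epsilon>' i)) ` A = {1}"
      using A by (force simp: Psi_def PiE_iff)+
    have "vnorm V (signed_indicator V e \<epsilon> A) \<le> C2 * vnorm V (indicator_sum V e A)"
      using UL[OF A(1,2), of \<epsilon>] by (simp add: im signed_indicator_def)
    also have "vnorm V (indicator_sum V e A) \<le> C1 * vnorm V (signed_indicator V e \<epsilon>' A)"
      using UL[OF A(1,2), of \<epsilon>'] C by (simp add: im signed_indicator_def field_simps)
    finally show ?thesis using C by (simp add: mult.assoc)
  qed
  moreover have "0 < C2 * C1" using C by simp
  ultimately show ?thesis unfolding unconditional_const_coeffs_def by blast
qed

section \<open>Sequence spaces defined by a family of seminorms\<close>

definition initial_part :: "nat \<Rightarrow> (nat \<Rightarrow> 'k::zero) \<Rightarrow> nat \<Rightarrow> 'k" where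
  "initial_part m x i = (if i < m then x i else 0)"

definition coord_vector :: "nat \<Rightarrow> nat \<Rightarrow> 'k::zero_neq_one" where
  "coord_vector i j = (if j = i then 1 else 0)"

definition scale_seq :: "'k::times \<Rightarrow> (nat \<Rightarrow> 'k) \<Rightarrow> nat \<Rightarrow> 'k" where
  "scale_seq a x i = a * x i"

lemma initial_part_eq_self: "(\<And>i. m \<le> i \<Longrightarrow> x i = 0) \<Longrightarrow> initial_part m x = x"
  by (auto simp: initial_part_def fun_eq_iff)

lemma initial_part_0 [simp]: "initial_part 0 x = 0"
  by (auto simp: initial_part_def fun_eq_iff)

lemma initial_part_Suc:
  fixes x :: "nat \<Rightarrow> 'k::comm_ring_1"
  shows "initial_part (Suc m) x = initial_part m x + scale_seq (x m) (coord_vector m)"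
  by (auto simp: initial_part_def coord_vector_def scale_seq_def fun_eq_iff less_Suc_eq)

lemma initial_part_diff:
  fixes x y :: "nat \<Rightarrow> 'k::comm_ring_1"
  shows "initial_part m (x - y) = initial_part m x - initial_part m y"
  by (auto simp: initial_part_def fun_eq_iff)

text \<open>
  These axioms make the supremum of the family a norm in which initial parts do not increase the norm,
  coordinates are contractive functionals, and coordinate vectors have norm one.  The continuity
  axiom says that each seminorm sees only finitely many coordinates in a continuous way; it is what
  turns coordinatewise limits of Cauchy sequences into norm limits.
\<close>

locale coordinate_seminorms =
  fixes Q :: "((nat \<Rightarrow> 'k::{real_normed_field,banach,second_countable_topology}) \<Rightarrow> real) set"
  assumes triangle: "q \<in> Q \<Longrightarrow> q (x + y) \<le> q x + q y"
    and homogeneous: "q \<in> Q \<Longrightarrow> q (scale_seq a x) = norm a * q x"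
    and pointwise_continuous: "\<lbrakk>q \<in> Q; \<And>i. (\<lambda>j. s j i) \<longlonglongrightarrow> x i\<rbrakk> \<Longrightarrow> (\<lambda>j. q (s j)) \<longlonglongrightarrow> q x"
    and truncation: "q \<in> Q \<Longrightarrow> \<exists>q'\<in>Q. \<forall>x. q (initial_part m x) \<le> q' x"
    and coordinate: "\<exists>q\<in>Q. \<forall>x. norm (x i) \<le> q x"
    and coord_vector_le: "q \<in> Q \<Longrightarrow> q (coord_vector i) \<le> 1"
begin

lemma nonempty: "Q \<noteq> {}"
  using coordinate by auto

lemma seminorm_zero [simp]: "q \<in> Q \<Longrightarrow> q 0 = 0"
proof -
  have "scale_seq 0 0 = (0 :: nat \<Rightarrow> 'k)" by (auto simp: scale_seq_def)
  thus "q \<in> Q \<Longrightarrow> q 0 = 0" using homogeneous[of q 0 0] by simp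
qed

lemma seminorm_uminus: "q \<in> Q \<Longrightarrow> q (- x) = q x"
proof -
  have "scale_seq (- 1) x = - x" by (auto simp: scale_seq_def)
  thus "q \<in> Q \<Longrightarrow> q (- x) = q x" using homogeneous[of q "- 1" x] by simp
qed

lemma seminorm_nonneg: "q \<in> Q \<Longrightarrow> 0 \<le> q x"
  using triangle[of q x "- x"] by (simp add: seminorm_uminus)

lemma triangle_diff: "q \<in> Q \<Longrightarrow> q (x - z) \<le> q (x - y) + q (y - z)"
  using triangle[of q "x - y" "y - z"] by simp

lemma diff_commute: "q \<in> Q \<Longrightarrow> q (x - y) = q (y - x)"
  using seminorm_uminus[of q "x - y"] by simp

text \<open>
  The \<open>\<ell>\<^sub>1\<close> norm dominates every seminorm of the family, so finitely supported sequences have finite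
  norm and can be approximated by those with coefficients in a dense set of scalars.
\<close>

lemma initial_part_le_sum: "q \<in> Q \<Longrightarrow> q (initial_part m x) \<le> (\<Sum>i<m. norm (x i))"
proof (induction m)
  case (Suc m)
  have "q (initial_part (Suc m) x) \<le> q (initial_part m x) + norm (x m) * q (coord_vector m)"
    unfolding initial_part_Suc using Suc.prems by (metis triangle homogeneous)
  moreover have "norm (x m) * q (coord_vector m) \<le> norm (x m) * 1"
    using coord_vector_le Suc.prems by (intro mult_left_mono) auto
  ultimately show ?case using Suc by simp
qed simp

text \<open>
  The closure of the finitely supported sequences.  Admitting all sequences of finite norm instead
  could lose separability and the density of the span of the coordinate vectors.
\<close>

definition seqs :: "(nat \<Rightarrow> 'k) set" where
  "seqs = {x. \<forall>\<epsilon>>0. \<exists>m y. \<forall>q\<in>Q. q (x - initial_part m y) \<le> \<epsilon>}"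

lemma seqsD: "x \<in> seqs \<Longrightarrow> 0 < \<epsilon> \<Longrightarrow> \<exists>m y. \<forall>q\<in>Q. q (x - initial_part m y) \<le> \<epsilon>"
  by (auto simp: seqs_def)

lemma initial_part_in_seqs [simp]: "initial_part m x \<in> seqs"
  unfolding seqs_def by (auto intro!: exI[of _ m] exI[of _ x])

lemma zero_in_seqs [simp]: "0 \<in> seqs"
  using initial_part_in_seqs[of 0] by simp

lemma coord_vector_in_seqs [simp]: "coord_vector i \<in> seqs"
  using initial_part_in_seqs[of "Suc i" "coord_vector i"]
  by (subst (asm) initial_part_eq_self) (auto simp: coord_vector_def)

lemma add_in_seqs [simp]:
  assumes "x \<in> seqs" "y \<in> seqs"
  shows "x + y \<in> seqs"
  unfolding seqs_def
proof safe
  fix \<epsilon> :: real assume "0 < \<epsilon>"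
  then obtain m u k v where uv: "\<And>q. q \<in> Q \<Longrightarrow> q (x - initial_part m u) \<le> \<epsilon> / 2"
    "\<And>q. q \<in> Q \<Longrightarrow> q (y - initial_part k v) \<le> \<epsilon> / 2"
    using seqsD[OF assms(1), of "\<epsilon> / 2"] seqsD[OF assms(2), of "\<epsilon> / 2"] by fastforce
  define w where "w = initial_part m u + initial_part k v"
  have w: "initial_part (m + k) w = w"
    by (intro initial_part_eq_self) (auto simp: w_def initial_part_def)
  have eq: "x + y - w = (x - initial_part m u) + (y - initial_part k v)" by (simp add: w_def algebra_simps)
  have "q (x + y - w) \<le> \<epsilon>" if "q \<in> Q" for q
    unfolding eq using triangle[OF that, of "x - initial_part m u" "y - initial_part k v"] uv[OF that] by linarith
  thus "\<exists>m y'. \<forall>q\<in>Q. q (x + y - initial_part m y') \<le> \<epsilon>" using w by metis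
qed

lemma scale_seq_in_seqs [simp]:
  assumes "x \<in> seqs"
  shows "scale_seq a x \<in> seqs"
  unfolding seqs_def
proof safe
  fix \<epsilon> :: real assume e: "0 < \<epsilon>"
  then obtain m u where u: "\<And>q. q \<in> Q \<Longrightarrow> q (x - initial_part m u) \<le> \<epsilon> / (norm a + 1)"
    using seqsD[OF assms, of "\<epsilon> / (norm a + 1)"] by (auto simp: add_nonneg_pos)
  have eq: "scale_seq a x - initial_part m (scale_seq a u) = scale_seq a (x - initial_part m u)"
    by (auto simp: scale_seq_def initial_part_def algebra_simps)
  have "q (scale_seq a x - initial_part m (scale_seq a u)) \<le> \<epsilon>" if "q \<in> Q" for q
  proof -
    have "norm a * q (x - initial_part m u) \<le> (norm a + 1) * (\<epsilon> / (norm a + 1))"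
      using u[OF that] seminorm_nonneg[OF that] e by (intro mult_mono) auto
    also have "\<dots> = \<epsilon>" by (simp add: add_nonneg_eq_0_iff)
    finally show ?thesis by (simp add: eq homogeneous that)
  qed
  thus "\<exists>m y. \<forall>q\<in>Q. q (scale_seq a x - initial_part m y) \<le> \<epsilon>" by blast
qed

lemma uminus_in_seqs [simp]: "x \<in> seqs \<Longrightarrow> - x \<in> seqs"
proof -
  have "scale_seq (- 1) x = - x" by (auto simp: scale_seq_def)
  thus "x \<in> seqs \<Longrightarrow> - x \<in> seqs" using scale_seq_in_seqs[of x "- 1"] by simp
qed

lemma diff_in_seqs [simp]: "x \<in> seqs \<Longrightarrow> y \<in> seqs \<Longrightarrow> x - y \<in> seqs"
  using add_in_seqs[of x "- y"] by simp

definition sup_norm :: "(nat \<Rightarrow> 'k) \<Rightarrow> real" where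
  "sup_norm x = (SUP q\<in>Q. q x)"

lemma bdd_above_seqs: 
  assumes "x \<in> seqs"
  shows "bdd_above ((\<lambda>q. q x) ` Q)"
proof -
  obtain m u where u: "\<And>q. q \<in> Q \<Longrightarrow> q (x - initial_part m u) \<le> 1"
    using seqsD[OF assms, of 1] by auto
  have "q x \<le> 1 + (\<Sum>i<m. norm (u i))" if "q \<in> Q" for q
    using triangle[OF that, of "x - initial_part m u" "initial_part m u"] u[OF that]
      initial_part_le_sum[OF that, of m u] by simp
  thus ?thesis by (intro bdd_aboveI2)
qed

lemma le_sup_norm: "x \<in> seqs \<Longrightarrow> q \<in> Q \<Longrightarrow> q x \<le> sup_norm x"
  unfolding sup_norm_def by (intro cSUP_upper bdd_above_seqs)

lemma sup_norm_le: "(\<And>q. q \<in> Q \<Longrightarrow> q x \<le> c) \<Longrightarrow> sup_norm x \<le> c"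
  unfolding sup_norm_def using nonempty by (intro cSUP_least)

lemma norm_coordinate_le: "x \<in> seqs \<Longrightarrow> norm (x i) \<le> sup_norm x"
  using coordinate[of i] le_sup_norm[of x] by (meson order_trans)

lemma sup_norm_nonneg: "x \<in> seqs \<Longrightarrow> 0 \<le> sup_norm x"
  using norm_coordinate_le[of x 0] norm_ge_zero order_trans by blast

lemma sup_norm_eq_0_iff: "x \<in> seqs \<Longrightarrow> sup_norm x = 0 \<longleftrightarrow> x = 0"
proof
  assume x: "x \<in> seqs" "sup_norm x = 0"
  show "x = 0" using norm_coordinate_le[OF x(1)] x(2) by (auto simp: fun_eq_iff)
next
  assume "x = 0" thus "sup_norm x = 0"
    using nonempty by (simp add: sup_norm_def)
qed

lemma sup_norm_0 [simp]: "sup_norm 0 = 0"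
  by (simp add: sup_norm_eq_0_iff)

lemma sup_norm_triangle: "x \<in> seqs \<Longrightarrow> y \<in> seqs \<Longrightarrow> sup_norm (x + y) \<le> sup_norm x + sup_norm y"
  using triangle le_sup_norm by (intro sup_norm_le) (meson add_mono order_trans)

lemma sup_norm_scale_seq_le: "x \<in> seqs \<Longrightarrow> sup_norm (scale_seq a x) \<le> norm a * sup_norm x"
  by (intro sup_norm_le) (auto simp: homogeneous intro!: mult_left_mono le_sup_norm)

lemma sup_norm_scale_seq:
  assumes "x \<in> seqs"
  shows "sup_norm (scale_seq a x) = norm a * sup_norm x"
proof (cases "a = 0")
  case True
  hence "scale_seq a x = 0" by (auto simp: scale_seq_def)
  thus ?thesis using True by simp
next
  case False
  have "scale_seq (inverse a) (scale_seq a x) = x" using False by (auto simp: scale_seq_def)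
  hence "sup_norm x \<le> inverse (norm a) * sup_norm (scale_seq a x)"
    using sup_norm_scale_seq_le[of "scale_seq a x" "inverse a"] assms by (simp add: norm_inverse)
  hence "norm a * sup_norm x \<le> sup_norm (scale_seq a x)" using False by (simp add: field_simps)
  with sup_norm_scale_seq_le[OF assms, of a] show ?thesis by simp
qed

lemma sup_norm_initial_part_le: "x \<in> seqs \<Longrightarrow> sup_norm (initial_part m x) \<le> sup_norm x"
  using truncation le_sup_norm by (intro sup_norm_le) (meson order_trans)

lemma sup_norm_coord_vector: "sup_norm (coord_vector i) = 1"
  using norm_coordinate_le[of "coord_vector i" i] sup_norm_le[of "coord_vector i" 1] coord_vector_le
  by (auto simp: coord_vector_def intro: antisym)

text \<open>
  A Cauchy sequence converges in each coordinate.  Each seminorm passes to this limit, which keeps the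
  Cauchy estimate uniform over the family, and approximability is inherited from a late member of the
  sequence.
\<close>

lemma seqs_complete:
  fixes \<sigma> :: "nat \<Rightarrow> nat \<Rightarrow> 'k"
  assumes \<sigma>: "\<And>j. \<sigma> j \<in> seqs"
    and Cauchy: "\<And>\<epsilon>. 0 < \<epsilon> \<Longrightarrow> \<exists>N. \<forall>j\<ge>N. \<forall>k\<ge>N. sup_norm (\<sigma> j - \<sigma> k) < \<epsilon>"
  shows "\<exists>x\<in>seqs. \<forall>\<epsilon>>0. \<exists>N. \<forall>j\<ge>N. sup_norm (\<sigma> j - x) \<le> \<epsilon>"
proof -
  have "convergent (\<lambda>j. \<sigma> j i)" for i
  proof (intro Cauchy_convergent CauchyI)
    fix \<epsilon> :: real assume "0 < \<epsilon>"
    then obtain N where N: "\<forall>j\<ge>N. \<forall>k\<ge>N. sup_norm (\<sigma> j - \<sigma> k) < \<epsilon>" using Cauchy by blast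
    have "norm (\<sigma> j i - \<sigma> k i) \<le> sup_norm (\<sigma> j - \<sigma> k)" for j k
      using norm_coordinate_le[of "\<sigma> j - \<sigma> k" i] \<sigma> by simp
    with N show "\<exists>M. \<forall>m\<ge>M. \<forall>n\<ge>M. norm (\<sigma> m i - \<sigma> n i) < \<epsilon>"
      by (meson le_less_trans)
  qed
  then obtain x where x: "\<And>i. (\<lambda>j. \<sigma> j i) \<longlonglongrightarrow> x i" unfolding convergent_def by metis
  have near: "\<exists>N. \<forall>j\<ge>N. \<forall>q\<in>Q. q (\<sigma> j - x) \<le> \<epsilon>" if "0 < \<epsilon>" for \<epsilon>
  proof -
    obtain N where N: "\<forall>j\<ge>N. \<forall>k\<ge>N. sup_norm (\<sigma> j - \<sigma> k) < \<epsilon>" using Cauchy \<open>0 < \<epsilon>\<close> by blast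
    have "q (\<sigma> j - x) \<le> \<epsilon>" if j: "N \<le> j" and q: "q \<in> Q" for j q
    proof (rule LIMSEQ_le_const2)
      show "(\<lambda>k. q (\<sigma> j - \<sigma> k)) \<longlonglongrightarrow> q (\<sigma> j - x)"
        by (intro pointwise_continuous[OF q]) (auto intro!: tendsto_intros x)
      show "\<exists>M. \<forall>k\<ge>M. q (\<sigma> j - \<sigma> k) \<le> \<epsilon>"
        using N j le_sup_norm[OF diff_in_seqs[OF \<sigma> \<sigma>] q, of j] by (meson less_imp_le order_trans)
    qed
    thus ?thesis by blast
  qed
  have "x \<in> seqs" unfolding seqs_def
  proof safe
    fix \<epsilon> :: real assume e: "0 < \<epsilon>"
    then obtain N where N: "\<forall>j\<ge>N. \<forall>q\<in>Q. q (\<sigma> j - x) \<le> \<epsilon> / 2" using near[of "\<epsilon> / 2"] by auto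
    obtain m y where y: "\<forall>q\<in>Q. q (\<sigma> N - initial_part m y) \<le> \<epsilon> / 2"
      using seqsD[OF \<sigma>[of N], of "\<epsilon> / 2"] e by auto
    have "q (x - initial_part m y) \<le> \<epsilon>" if q: "q \<in> Q" for q
    proof -
      have "q (x - initial_part m y) \<le> q (x - \<sigma> N) + q (\<sigma> N - initial_part m y)" by (rule triangle_diff[OF q])
      also have "q (x - \<sigma> N) \<le> \<epsilon> / 2" using N q by (simp add: diff_commute)
      also have "q (\<sigma> N - initial_part m y) \<le> \<epsilon> / 2" using y q by simp
      finally show ?thesis by simp
    qed
    thus "\<exists>m y. \<forall>q\<in>Q. q (x - initial_part m y) \<le> \<epsilon>" by blast
  qed
  moreover have "\<exists>N. \<forall>j\<ge>N. sup_norm (\<sigma> j - x) \<le> \<epsilon>" if "0 < \<epsilon>" for \<epsilon>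
    using near[OF that] sup_norm_le by meson
  ultimately show ?thesis by blast
qed

text \<open>
  Finitely supported sequences with coefficients in a countable dense set of scalars.
\<close>

lemma countable_dense_seqs:
  obtains E where "countable E" "E \<subseteq> seqs" "\<And>x \<epsilon>. x \<in> seqs \<Longrightarrow> 0 < \<epsilon> \<Longrightarrow> \<exists>y\<in>E. sup_norm (x - y) < \<epsilon>"
proof -
  obtain D :: "'k set" where D: "countable D" "\<And>U. open U \<Longrightarrow> U \<noteq> {} \<Longrightarrow> \<exists>d\<in>D. d \<in> U"
    using countable_dense_exists by blast
  define E where "E = (\<lambda>ds. initial_part (length ds) (\<lambda>i. ds ! i)) ` lists D"
  have "\<exists>y\<in>E. sup_norm (x - y) < \<epsilon>" if x: "x \<in> seqs" and e: "0 < \<epsilon>" for x \<epsilon>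
  proof -
    obtain m y where y: "\<And>q. q \<in> Q \<Longrightarrow> q (x - initial_part m y) \<le> \<epsilon> / 3"
      using seqsD[OF x, of "\<epsilon> / 3"] e by auto
    define \<delta> where "\<delta> = \<epsilon> / (3 * (real m + 1))"
    have "\<delta> > 0" using e by (simp add: \<delta>_def)
    hence "\<exists>d\<in>D. d \<in> ball (y i) \<delta>" for i by (intro D) auto
    then obtain d where d: "\<And>i. d i \<in> D" "\<And>i. norm (y i - d i) < \<delta>" by (metis mem_ball dist_norm)
    have "initial_part m d = initial_part (length (map d [0..<m])) (\<lambda>i. map d [0..<m] ! i)"
      by (auto simp: initial_part_def fun_eq_iff)
    hence dE: "initial_part m d \<in> E" unfolding E_def using d(1) by (intro image_eqI[where x = "map d [0..<m]"]) auto
    have "q (x - initial_part m d) \<le> 2 * \<epsilon> / 3" if q: "q \<in> Q" for q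
    proof -
      have "q (x - initial_part m d) \<le> q (x - initial_part m y) + q (initial_part m y - initial_part m d)"
        by (rule triangle_diff[OF q])
      also have "q (initial_part m y - initial_part m d) \<le> (\<Sum>i<m. norm ((y - d) i))"
        using initial_part_le_sum[OF q, of m "y - d"] by (simp only: initial_part_diff)
      also have "\<dots> \<le> (\<Sum>i<m. \<delta>)" using d(2) by (intro sum_mono) (auto intro: less_imp_le)
      also have "\<dots> \<le> \<epsilon> / 3" using e by (simp add: \<delta>_def field_simps)
      finally show ?thesis using y[OF q] by linarith
    qed
    hence "sup_norm (x - initial_part m d) \<le> 2 * \<epsilon> / 3" by (rule sup_norm_le)
    thus ?thesis using dE e by (intro bexI[of _ "initial_part m d"]) auto
  qed
  moreover have "countable E" "E \<subseteq> seqs" using D(1) by (auto simp: E_def)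
  ultimately show ?thesis using that by blast
qed

end

section \<open>The sequence space as a Banach space with a Schauder basis\<close>

text \<open>
  The injection \<open>\<phi>\<close> places the sequences in the given type; all vector space operations are
  transported along it.
\<close>

locale coordinate_space = coordinate_seminorms Q
  for Q :: "((nat \<Rightarrow> 'k::{real_normed_field,banach,second_countable_topology}) \<Rightarrow> real) set" +
  fixes \<phi> :: "(nat \<Rightarrow> 'k) \<Rightarrow> 'v"
  assumes inj_copy: "inj \<phi>"
begin

abbreviation "\<psi> \<equiv> inv_into UNIV \<phi>"

definition seq_space :: "('k, 'v) normed_module" where
  "seq_space = \<lparr>carrier = \<phi> ` seqs, mult = (\<lambda>u v. u), one = \<phi> 0, zero = \<phi> 0,
     add = (\<lambda>u v. \<phi> (\<psi> u + \<psi> v)), smult = (\<lambda>a v. \<phi> (scale_seq a (\<psi> v))),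
     vnorm = (\<lambda>v. sup_norm (\<psi> v))\<rparr>"

definition basis :: "nat \<Rightarrow> 'v" where
  "basis i = \<phi> (coord_vector i)"

lemma \<psi>_\<phi> [simp]: "\<psi> (\<phi> x) = x"
  using inj_copy by simp

lemma seq_space_simps:
  "carrier seq_space = \<phi> ` seqs"
  "\<zero>\<^bsub>seq_space\<^esub> = \<phi> 0"
  "\<phi> x \<oplus>\<^bsub>seq_space\<^esub> \<phi> y = \<phi> (x + y)"
  "a \<odot>\<^bsub>seq_space\<^esub> \<phi> x = \<phi> (scale_seq a x)"
  "vnorm seq_space (\<phi> x) = sup_norm x"
  by (simp_all add: seq_space_def)

lemma copy_eq_iff [simp]: "\<phi> x = \<phi> y \<longleftrightarrow> x = y"
  using inj_copy by (auto dest: injD)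

lemma copy_in_carrier [simp]: "\<phi> x \<in> carrier seq_space \<longleftrightarrow> x \<in> seqs"
  by (auto simp: seq_space_simps)

lemma carrierE:
  assumes "v \<in> carrier seq_space"
  obtains x where "x \<in> seqs" "v = \<phi> x"
  using assms by (auto simp: seq_space_simps)

lemma scale_seq_simps:
  "scale_seq (a + b) x = scale_seq a x + scale_seq b x" "scale_seq a (x + y) = scale_seq a x + scale_seq a (y :: nat \<Rightarrow> 'k)"
  "scale_seq (a * b) x = scale_seq a (scale_seq b x)" "scale_seq 1 x = x"
  by (auto simp: scale_seq_def algebra_simps fun_eq_iff)

sublocale normed_vector_space seq_space
proof -
  have "abelian_group seq_space"
  proof (rule abelian_groupI)
    fix v assume "v \<in> carrier seq_space"
    then obtain x where x: "x \<in> seqs" "v = \<phi> x" by (rule carrierE)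
    show "\<exists>w\<in>carrier seq_space. w \<oplus>\<^bsub>seq_space\<^esub> v = \<zero>\<^bsub>seq_space\<^esub>"
      using x by (intro bexI[of _ "\<phi> (- x)"]) (auto simp: seq_space_simps)
  qed (auto elim!: carrierE simp: seq_space_simps add_ac)
  moreover have "cring (ring_of_type_algebra :: 'k ring)" by (rule cring_from_type_algebra)
  ultimately have "module (ring_of_type_algebra :: 'k ring) seq_space"
    by (intro moduleI) (auto elim!: carrierE simp: seq_space_simps scale_seq_simps ring_of_type_algebra_def)
  moreover have "normed_vector_space_axioms seq_space"
    by unfold_locales
      (auto elim!: carrierE simp: seq_space_simps sup_norm_nonneg sup_norm_eq_0_iff sup_norm_scale_seq sup_norm_triangle)
  ultimately show "normed_vector_space seq_space" by (intro normed_vector_space.intro)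
qed

lemma minus_copy: "x \<in> seqs \<Longrightarrow> \<ominus>\<^bsub>seq_space\<^esub> \<phi> x = \<phi> (- x)"
  by (intro M.minus_equality) (auto simp: seq_space_simps)

lemma vdist_copy: "x \<in> seqs \<Longrightarrow> y \<in> seqs \<Longrightarrow> vdist seq_space (\<phi> x) (\<phi> y) = sup_norm (x - y)"
  by (simp add: vdist_def M.minus_eq minus_copy seq_space_simps(3,5))

lemma basis_in_carrier [simp]: "basis i \<in> carrier seq_space"
  by (simp add: basis_def)

text \<open>
  The left-hand side is the abstract sum in the transported module; through this identity all norms of
  finite sums become norms of explicit sequences.
\<close>

lemma finsum_basis:
  assumes "finite A"
  shows "(\<Oplus>\<^bsub>seq_space\<^esub>i\<in>A. a i \<odot>\<^bsub>seq_space\<^esub> basis i) = \<phi> (\<lambda>i. if i \<in> A then a i else 0)"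
  using assms
proof induction
  case empty
  show ?case by (simp add: seq_space_simps zero_fun_def)
next
  case (insert j A)
  have "(\<Oplus>\<^bsub>seq_space\<^esub>i\<in>insert j A. a i \<odot>\<^bsub>seq_space\<^esub> basis i)
      = a j \<odot>\<^bsub>seq_space\<^esub> basis j \<oplus>\<^bsub>seq_space\<^esub> (\<Oplus>\<^bsub>seq_space\<^esub>i\<in>A. a i \<odot>\<^bsub>seq_space\<^esub> basis i)"
    using insert.hyps by (intro M.finsum_insert) (auto simp: ring_of_type_algebra_def)
  also have "\<dots> = \<phi> (scale_seq (a j) (coord_vector j) + (\<lambda>i. if i \<in> A then a i else 0))"
    unfolding insert.IH by (simp add: basis_def seq_space_simps)
  also have "scale_seq (a j) (coord_vector j) + (\<lambda>i. if i \<in> A then a i else 0)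
      = (\<lambda>i. if i \<in> insert j A then a i else 0)"
    using insert.hyps by (auto simp: scale_seq_def coord_vector_def fun_eq_iff)
  finally show ?case .
qed

lemma finsum_basis_lessThan:
  "(\<Oplus>\<^bsub>seq_space\<^esub>i\<in>{..<m}. a i \<odot>\<^bsub>seq_space\<^esub> basis i) = \<phi> (initial_part m a)"
  by (simp add: finsum_basis initial_part_def[abs_def])

lemma initial_part_in_linear_span: "\<phi> (initial_part m x) \<in> linear_span seq_space (range basis)"
proof -
  have "\<phi> (initial_part m x) \<in> H"
    if H: "submodule H (ring_of_type_algebra :: 'k ring) seq_space" "range basis \<subseteq> H" for H
  proof (induction m)
    case 0
    have "\<zero>\<^bsub>seq_space\<^esub> \<in> H"
      using subgroup.one_closed[OF submodule.axioms(1)[OF H(1)]] by simp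
    thus ?case by (simp only: initial_part_0 seq_space_simps)
  next
    case (Suc m)
    have "basis m \<in> H" using H(2) by auto
    hence "x m \<odot>\<^bsub>seq_space\<^esub> basis m \<in> H" using submoduleE(4)[OF H(1)] by simp
    with submoduleE(5)[OF H(1) Suc.IH] have "\<phi> (initial_part m x) \<oplus>\<^bsub>seq_space\<^esub> x m \<odot>\<^bsub>seq_space\<^esub> basis m \<in> H" by blast
    thus ?case by (simp only: initial_part_Suc basis_def seq_space_simps)
  qed
  thus ?thesis unfolding linear_span_def hull_def by blast
qed

lemma closure_linear_span_basis:
  "norm_topology seq_space closure_of linear_span seq_space (range basis) = carrier seq_space"
proof -
  interpret MS: Metric_space "carrier seq_space" "vdist seq_space" by (rule Metric_space_vdist)
  have "\<exists>v\<in>linear_span seq_space (range basis). v \<in> MS.mball (\<phi> x) r"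
    if x: "x \<in> seqs" and r: "r > 0" for x r
  proof -
    obtain m y where y: "\<And>q. q \<in> Q \<Longrightarrow> q (x - initial_part m y) \<le> r / 2"
      using seqsD[OF x, of "r / 2"] r by auto
    have "sup_norm (x - initial_part m y) \<le> r / 2" using y by (rule sup_norm_le)
    hence "\<phi> (initial_part m y) \<in> MS.mball (\<phi> x) r"
      using x r by (simp add: MS.in_mball vdist_copy)
    thus ?thesis using initial_part_in_linear_span by blast
  qed
  thus ?thesis unfolding MS.metric_closure_of by (auto elim!: carrierE)
qed

text \<open>
  A finite spanning set would, inside the vector space of all sequences, span the infinitely many
  linearly independent coordinate vectors.
\<close>

lemma infinite_dimensional: "\<not> finite_dimensional seq_space"
proof
  interpret vs: vector_space "scale_seq :: 'k \<Rightarrow> (nat \<Rightarrow> 'k) \<Rightarrow> nat \<Rightarrow> 'k"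
    by unfold_locales (auto simp: scale_seq_def algebra_simps fun_eq_iff)
  assume "finite_dimensional seq_space"
  then obtain S where S: "finite S" "S \<subseteq> carrier seq_space" "linear_span seq_space S = carrier seq_space"
    unfolding finite_dimensional_def by blast
  define T where "T = \<psi> ` S"
  have "submodule (\<phi> ` (vs.span T \<inter> seqs)) (ring_of_type_algebra :: 'k ring) seq_space"
    by (rule submoduleI)
      (auto simp: minus_copy seq_space_simps vs.span_neg vs.span_add vs.span_scale vs.span_zero)
  moreover have "S \<subseteq> \<phi> ` (vs.span T \<inter> seqs)"
  proof
    fix v assume v: "v \<in> S"
    then obtain x where x: "x \<in> seqs" "v = \<phi> x" using S(2) by (auto elim: carrierE)
    hence "x \<in> T" using v by (auto simp: T_def intro: rev_image_eqI)
    thus "v \<in> \<phi> ` (vs.span T \<inter> seqs)" using x by (auto intro: vs.span_base)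
  qed
  ultimately have "linear_span seq_space S \<subseteq> \<phi> ` (vs.span T \<inter> seqs)"
    unfolding linear_span_def by (intro hull_minimal)
  hence "\<phi> ` seqs \<subseteq> \<phi> ` (vs.span T \<inter> seqs)" using S(3) by (simp add: seq_space_simps)
  hence sub: "seqs \<subseteq> vs.span T" by (auto simp: image_subset_iff)
  define B where "B = range (coord_vector :: nat \<Rightarrow> nat \<Rightarrow> 'k)"
  have inj: "inj (coord_vector :: nat \<Rightarrow> nat \<Rightarrow> 'k)"
  proof
    fix i j :: nat assume "(coord_vector i :: nat \<Rightarrow> 'k) = coord_vector j"
    from fun_cong[OF this, of i] show "i = j" by (auto simp: coord_vector_def split: if_splits)
  qed
  have "vs.independent B"
  proof
    assume "vs.dependent B"
    then obtain i where i: "coord_vector i \<in> vs.span (B - {coord_vector i :: nat \<Rightarrow> 'k})"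
      by (auto simp: vs.dependent_def B_def)
    \<comment> \<open>All other coordinate vectors vanish in the coordinate \<open>i\<close>.\<close>
    have "vs.span (B - {coord_vector i}) \<subseteq> {x. x i = 0}"
      by (rule vs.span_minimal) (auto simp: B_def coord_vector_def vs.subspace_def scale_seq_def)
    with i show False by (auto simp: coord_vector_def)
  qed
  moreover have "B \<subseteq> vs.span T" using sub by (auto simp: B_def)
  moreover have "finite T" using S by (simp add: T_def)
  ultimately have "finite B" using vs.independent_span_bound by blast
  thus False using inj by (simp add: B_def finite_image_iff)
qed

lemma banach_space: "banach_space seq_space"
proof (intro banach_space.intro banach_space_axioms.intro)
  interpret MS: Metric_space "carrier seq_space" "vdist seq_space" by (rule Metric_space_vdist)
  show "MS.mcomplete"
    unfolding MS.mcomplete_def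
  proof safe
    fix s assume s: "MS.MCauchy s"
    define \<sigma> where "\<sigma> j = \<psi> (s j)" for j
    have \<sigma>: "\<sigma> j \<in> seqs" "s j = \<phi> (\<sigma> j)" for j
    proof -
      have "s j \<in> carrier seq_space" using s by (auto simp: MS.MCauchy_def)
      then obtain x where "x \<in> seqs" "s j = \<phi> x" by (rule carrierE)
      thus "\<sigma> j \<in> seqs" "s j = \<phi> (\<sigma> j)" by (simp_all add: \<sigma>_def)
    qed
    have "\<exists>N. \<forall>j\<ge>N. \<forall>k\<ge>N. sup_norm (\<sigma> j - \<sigma> k) < \<epsilon>" if "0 < \<epsilon>" for \<epsilon>
    proof -
      have "\<exists>N. \<forall>j k. N \<le> j \<longrightarrow> N \<le> k \<longrightarrow> vdist seq_space (s j) (s k) < \<epsilon>"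
        using s that by (simp add: MS.MCauchy_def)
      thus ?thesis using \<sigma>(1) by (simp only: \<sigma>(2) vdist_copy) blast
    qed
    hence "\<exists>x\<in>seqs. \<forall>\<epsilon>>0. \<exists>N. \<forall>j\<ge>N. sup_norm (\<sigma> j - x) \<le> \<epsilon>"
      by (intro seqs_complete \<sigma>(1))
    then obtain x where x: "x \<in> seqs" "\<And>\<epsilon>. 0 < \<epsilon> \<Longrightarrow> \<exists>N. \<forall>j\<ge>N. sup_norm (\<sigma> j - x) \<le> \<epsilon>"
      by blast
    have "\<exists>N. \<forall>j\<ge>N. s j \<in> carrier seq_space \<and> vdist seq_space (s j) (\<phi> x) < \<epsilon>" if "0 < \<epsilon>" for \<epsilon>
    proof -
      obtain N where "\<forall>j\<ge>N. sup_norm (\<sigma> j - x) \<le> \<epsilon> / 2" using x(2)[of "\<epsilon> / 2"] \<open>0 < \<epsilon>\<close> by auto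
      hence "\<forall>j\<ge>N. sup_norm (\<sigma> j - x) < \<epsilon>" using \<open>0 < \<epsilon>\<close> by fastforce
      thus ?thesis using \<sigma> x(1) by (auto simp: vdist_copy)
    qed
    thus "\<exists>v. limitin MS.mtopology s v sequentially"
      using x(1) unfolding MS.limit_metric_sequentially by (intro exI[of _ "\<phi> x"]) auto
  qed
  show "normed_vector_space seq_space" by (rule normed_vector_space_axioms)
  obtain E where E: "countable E" "E \<subseteq> seqs"
    "\<And>x \<epsilon>. x \<in> seqs \<Longrightarrow> 0 < \<epsilon> \<Longrightarrow> \<exists>y\<in>E. sup_norm (x - y) < \<epsilon>"
    using countable_dense_seqs by blast
  have "MS.mtopology closure_of (\<phi> ` E) = carrier seq_space"
  proof -
    have "\<exists>v\<in>\<phi> ` E. v \<in> MS.mball (\<phi> x) r" if x: "x \<in> seqs" "0 < r" for x r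
      using E(3)[OF x] E(2) x(1) by (force simp: MS.in_mball vdist_copy)
    thus ?thesis unfolding MS.metric_closure_of by (auto elim!: carrierE)
  qed
  thus "separable_space MS.mtopology"
    unfolding separable_space_def using E by (intro exI[of _ "\<phi> ` E"]) auto
  show "\<not> finite_dimensional seq_space" by (rule infinite_dimensional)
qed

text \<open>
  The coordinate functionals are biorthogonal to the basis.  They have norm one, and
  the partial sum projections are the initial parts, which are contractive.
\<close>

lemma schauder_basis: "schauder_basis seq_space basis"
proof -
  define f where "f i = restrict (\<lambda>v. \<psi> v i) (carrier seq_space)" for i
  have f: "f i (\<phi> x) = x i" if "x \<in> seqs" for i x using that by (simp add: f_def)
  have dual: "f i \<in> dual seq_space" for i
    unfolding dual_def
  proof safe
    show "f i \<in> extensional (carrier seq_space)" by (simp add: f_def)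
    show "\<exists>C. \<forall>v\<in>carrier seq_space. norm (f i v) \<le> C * vnorm seq_space v"
      by (intro exI[of _ 1]) (auto elim!: carrierE simp: f seq_space_simps norm_coordinate_le)
  qed (auto elim!: carrierE simp: f seq_space_simps scale_seq_def)
  have le1: "norm (f i v) \<le> 1" if "v \<in> carrier seq_space" "vnorm seq_space v \<le> 1" for i v
    using that by (auto elim!: carrierE simp: f seq_space_simps intro: order_trans[OF norm_coordinate_le])
  have dual_norm: "dual_norm seq_space (f i) = 1" for i
    unfolding dual_norm_def
  proof (rule antisym)
    show "(SUP v\<in>{v \<in> carrier seq_space. vnorm seq_space v \<le> 1}. norm (f i v)) \<le> 1"
      using le1 by (intro cSUP_least) (auto intro!: bexI[of _ 0] simp: seq_space_simps)
    have "norm (f i (basis i)) \<le> (SUP v\<in>{v \<in> carrier seq_space. vnorm seq_space v \<le> 1}. norm (f i v))"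
      using le1 by (intro cSUP_upper bdd_aboveI2[where M = 1]) (auto simp: basis_def seq_space_simps sup_norm_coord_vector)
    thus "1 \<le> (SUP v\<in>{v \<in> carrier seq_space. vnorm seq_space v \<le> 1}. norm (f i v))"
      by (simp add: basis_def f coord_vector_def)
  qed
  have "basis_with seq_space basis f"
    unfolding basis_with_def using dual closure_linear_span_basis
    by (auto simp: dual_norm basis_def f seq_space_simps(5) sup_norm_coord_vector)
      (auto simp: coord_vector_def)
  moreover have "v = \<zero>\<^bsub>seq_space\<^esub>" if "v \<in> carrier seq_space" "\<forall>i. f i v = 0" for v
    using that by (auto elim!: carrierE simp: f seq_space_simps fun_eq_iff)
  moreover have "vnorm seq_space (\<Oplus>\<^bsub>seq_space\<^esub>i\<in>{..<m}. f i v \<odot>\<^bsub>seq_space\<^esub> basis i) \<le> 1 * vnorm seq_space v"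
    if "v \<in> carrier seq_space" for v m
    using that by (auto elim!: carrierE simp: finsum_basis_lessThan f seq_space_simps(5) sup_norm_initial_part_le)
  ultimately show ?thesis unfolding schauder_basis_def using zero_less_one by blast
qed

end

section \<open>A space with the UL property along a sequence with large gaps\<close>

text \<open>
  The first family has the \<open>\<ell>\<^sub>2\<close> norm as its supremum.  The range \<open>r \<le> \<surd>(n\<^sub>k n\<^sub>k\<^sub>+\<^sub>1)\<close> in the second
  is chosen at the geometric mean of two consecutive terms: the partial sums are then controlled on
  all cardinalities in the range of \<open>n\<close>, but not near the geometric mean of terms that are far apart.
\<close>

definition partial_sum_seminorms :: "(nat \<Rightarrow> nat) \<Rightarrow> ((nat \<Rightarrow> 'k::real_normed_field) \<Rightarrow> real) set" where
  "partial_sum_seminorms n =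
     range (\<lambda>N x. L2_set (\<lambda>i. norm (x i)) {..<N}) \<union>
     (\<lambda>(k, r) x. norm (\<Sum>i<r. x i) / sqrt (real (n k))) ` {(k, r). r\<^sup>2 \<le> n k * n (Suc k)}"

lemma partial_sum_seminormsE:
  assumes "q \<in> partial_sum_seminorms n"
  obtains N where "q = (\<lambda>x. L2_set (\<lambda>i. norm (x i)) {..<N})"
  | k r where "r\<^sup>2 \<le> n k * n (Suc k)" "q = (\<lambda>x. norm (\<Sum>i<r. x i) / sqrt (real (n k)))"
  using assms by (auto simp: partial_sum_seminorms_def)

lemma L2_set_in_partial_sum_seminorms:
  "(\<lambda>x. L2_set (\<lambda>i. norm (x i)) {..<N}) \<in> partial_sum_seminorms n"
  by (auto simp: partial_sum_seminorms_def)

lemma partial_sum_in_partial_sum_seminorms: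
  "r\<^sup>2 \<le> n k * n (Suc k) \<Longrightarrow>
    (\<lambda>x. norm (\<Sum>i<r. x i) / sqrt (real (n k))) \<in> partial_sum_seminorms n"
  unfolding partial_sum_seminorms_def by (intro UnI2 image_eqI[where x = "(k, r)"]) auto

lemma sum_initial_part: "(\<Sum>i<r. initial_part m x i) = (\<Sum>i<min m r. x i)"
  by (rule sum.mono_neutral_cong_right) (auto simp: initial_part_def)

lemma L2_set_initial_part:
  fixes x :: "nat \<Rightarrow> 'k::real_normed_field"
  shows "L2_set (\<lambda>i. norm (initial_part m x i)) {..<N} \<le> L2_set (\<lambda>i. norm (x i)) {..<N}"
  by (intro L2_set_mono) (auto simp: initial_part_def)

text \<open>
  Initial parts turn the partial sum of length \<open>r\<close> into the one of length \<open>min m r\<close>, whose seminorm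
  again belongs to the family.
\<close>

lemma coordinate_seminorms_partial_sums:
  assumes "\<And>k. 0 < n k"
  shows "coordinate_seminorms
    (partial_sum_seminorms n :: ((nat \<Rightarrow> 'k::{real_normed_field,banach,second_countable_topology}) \<Rightarrow> real) set)"
proof
  fix q :: "(nat \<Rightarrow> 'k) \<Rightarrow> real" and x y :: "nat \<Rightarrow> 'k" assume "q \<in> partial_sum_seminorms n"
  thus "q (x + y) \<le> q x + q y"
  proof (cases rule: partial_sum_seminormsE)
    case (1 N)
    have "q (x + y) \<le> L2_set (\<lambda>i. norm (x i) + norm (y i)) {..<N}"
      unfolding 1 by (intro L2_set_mono) (auto intro: norm_triangle_ineq)
    also have "\<dots> \<le> q x + q y" unfolding 1 by (rule L2_set_triangle_ineq)
    finally show ?thesis .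
  next
    case (2 k r)
    show ?thesis unfolding 2 add_divide_distrib[symmetric]
      by (intro divide_right_mono) (auto simp: sum.distrib norm_triangle_ineq)
  qed
next
  fix q :: "(nat \<Rightarrow> 'k) \<Rightarrow> real" and x :: "nat \<Rightarrow> 'k" and a assume "q \<in> partial_sum_seminorms n"
  thus "q (scale_seq a x) = norm a * q x"
    by (cases rule: partial_sum_seminormsE)
      (auto simp: scale_seq_def norm_mult L2_set_right_distrib simp flip: sum_distrib_left)
next
  fix q :: "(nat \<Rightarrow> 'k) \<Rightarrow> real" and s and x :: "nat \<Rightarrow> 'k"
  assume "q \<in> partial_sum_seminorms n" and s: "\<And>i. (\<lambda>j. s j i) \<longlonglongrightarrow> x i"
  from this(1) show "(\<lambda>j. q (s j)) \<longlonglongrightarrow> q x"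
  proof (cases rule: partial_sum_seminormsE)
    case (1 N)
    show ?thesis unfolding 1 L2_set_def by (intro tendsto_intros s)
  next
    case (2 k r)
    show ?thesis unfolding 2 using assms[of k] by (intro tendsto_intros s) auto
  qed
next
  fix q :: "(nat \<Rightarrow> 'k) \<Rightarrow> real" and m assume "q \<in> partial_sum_seminorms n"
  thus "\<exists>q'\<in>partial_sum_seminorms n. \<forall>x. q (initial_part m x) \<le> q' x"
  proof (cases rule: partial_sum_seminormsE)
    case (1 N)
    show ?thesis unfolding 1
      by (intro bexI[OF _ L2_set_in_partial_sum_seminorms] allI) (rule L2_set_initial_part)
  next
    case (2 k r)
    have "(min m r)\<^sup>2 \<le> r\<^sup>2" by (intro power_mono) auto
    hence "(min m r)\<^sup>2 \<le> n k * n (Suc k)" using 2(1) by linarith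
    hence "(\<lambda>x. norm (\<Sum>i<min m r. x i) / sqrt (real (n k))) \<in> (partial_sum_seminorms n :: ((nat \<Rightarrow> 'k) \<Rightarrow> real) set)"
      by (rule partial_sum_in_partial_sum_seminorms)
    thus ?thesis unfolding 2 sum_initial_part by (rule rev_bexI) simp
  qed
next
  fix i :: nat
  have "norm (x i) \<le> L2_set (\<lambda>i. norm (x i)) {..<Suc i}" for x :: "nat \<Rightarrow> 'k"
    by (intro member_le_L2_set) auto
  thus "\<exists>q\<in>partial_sum_seminorms n. \<forall>x :: nat \<Rightarrow> 'k. norm (x i) \<le> q x"
    by (intro bexI[OF _ L2_set_in_partial_sum_seminorms] allI)
next
  fix q :: "(nat \<Rightarrow> 'k) \<Rightarrow> real" and i assume "q \<in> partial_sum_seminorms n"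
  thus "q (coord_vector i) \<le> 1"
  proof (cases rule: partial_sum_seminormsE)
    case (1 N)
    have "q (coord_vector i) \<le> (\<Sum>j<N. norm (coord_vector i j :: 'k))"
      unfolding 1 by (rule L2_set_le_sum) auto
    also have "\<dots> \<le> 1" by (simp add: coord_vector_def if_distrib cong: if_cong)
    finally show ?thesis .
  next
    case (2 k r)
    have "norm (\<Sum>j<r. coord_vector i j :: 'k) \<le> 1" by (simp add: coord_vector_def)
    moreover have "1 \<le> sqrt (real (n k))" using assms[of k] by simp
    ultimately have "norm (\<Sum>j<r. coord_vector i j :: 'k) \<le> sqrt (real (n k))" by linarith
    thus ?thesis unfolding 2 using assms[of k] by simp
  qed
qed

lemma L2_set_le_of_bounded:
  fixes A :: "nat set"
  assumes "finite A" "\<And>i. i \<in> A \<Longrightarrow> norm (x i) \<le> c" "\<And>i. i \<notin> A \<Longrightarrow> x i = 0" "0 \<le> c"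
  shows "L2_set (\<lambda>i. norm (x i)) {..<N} \<le> c * sqrt (real (card A))"
proof -
  have "(\<Sum>i<N. (norm (x i))\<^sup>2) \<le> (\<Sum>i\<in>A. c\<^sup>2)"
  proof -
    have "(\<Sum>i<N. (norm (x i))\<^sup>2) = (\<Sum>i\<in>{..<N} \<inter> A. (norm (x i))\<^sup>2)"
      using assms by (intro sum.mono_neutral_right) auto
    also have "\<dots> \<le> (\<Sum>i\<in>{..<N} \<inter> A. c\<^sup>2)" using assms by (intro sum_mono power_mono) auto
    also have "\<dots> \<le> (\<Sum>i\<in>A. c\<^sup>2)" using assms by (intro sum_mono2) auto
    finally show ?thesis .
  qed
  hence "L2_set (\<lambda>i. norm (x i)) {..<N} \<le> sqrt (\<Sum>i\<in>A. c\<^sup>2)"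
    unfolding L2_set_def by (rule real_sqrt_le_mono)
  also have "\<dots> = c * sqrt (real (card A))" using assms by (simp add: real_sqrt_mult)
  finally show ?thesis .
qed

lemma le_L2_set_of_bounded:
  fixes A :: "nat set"
  assumes "finite A" "\<And>i. i \<in> A \<Longrightarrow> c \<le> norm (x i)" "0 \<le> c"
  shows "\<exists>N. c * sqrt (real (card A)) \<le> L2_set (\<lambda>i. norm (x i)) {..<N}"
proof -
  define N where "N = Suc (Max A)"
  have N: "A \<subseteq> {..<N}" using assms(1) by (auto simp: N_def less_Suc_eq_le)
  have "c * sqrt (real (card A)) = sqrt (\<Sum>i\<in>A. c\<^sup>2)" using assms(3) by (simp add: real_sqrt_mult)
  also have "\<dots> \<le> sqrt (\<Sum>i\<in>A. (norm (x i))\<^sup>2)"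
    using assms(2,3) by (intro real_sqrt_le_mono sum_mono power_mono)
  also have "\<dots> \<le> sqrt (\<Sum>i\<in>{..<N}. (norm (x i))\<^sup>2)"
    using N by (intro real_sqrt_le_mono sum_mono2) auto
  finally show ?thesis unfolding L2_set_def by (rule exI[of _ N])
qed

text \<open>
  The sum meets at most \<open>min r n\<^sub>j\<close> elements of \<open>A\<close>, where \<open>n\<^sub>j\<close> is the cardinality of \<open>A\<close>.  If
  \<open>j \<le> k\<close>, then \<open>n\<^sub>j \<le> \<surd>n\<^sub>j \<surd>n\<^sub>k\<close>; otherwise \<open>r \<le> \<surd>n\<^sub>k \<surd>n\<^sub>k\<^sub>+\<^sub>1 \<le> \<surd>n\<^sub>k \<surd>n\<^sub>j\<close>.
\<close>

lemma partial_sum_le: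
  assumes n: "gap_sequence n" and A: "finite A" "card A \<in> range n"
    and x: "\<And>i. i \<in> A \<Longrightarrow> norm (x i) \<le> c" "\<And>i. i \<notin> A \<Longrightarrow> x i = 0" "0 \<le> c"
    and r: "r\<^sup>2 \<le> n k * n (Suc k)"
  shows "norm (\<Sum>i<r. x i) / sqrt (real (n k)) \<le> c * sqrt (real (card A))"
proof -
  have pos: "0 < n j" for j using n by (auto simp: gap_sequence_def)
  obtain j where j: "card A = n j" using A by auto
  have "(\<Sum>i<r. x i) = (\<Sum>i\<in>{..<r} \<inter> A. x i)" using x by (intro sum.mono_neutral_right) auto
  also have "norm \<dots> \<le> (\<Sum>i\<in>{..<r} \<inter> A. c)" using x by (intro sum_norm_le) auto
  also have "\<dots> = c * real (card ({..<r} \<inter> A))" by simp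
  finally have 1: "norm (\<Sum>i<r. x i) \<le> c * real (card ({..<r} \<inter> A))" .
  have "real (card ({..<r} \<inter> A)) \<le> sqrt (real (n j)) * sqrt (real (n k))"
  proof (cases "j \<le> k")
    case True
    have "card ({..<r} \<inter> A) \<le> n j" using A j by (metis card_mono Int_lower2)
    hence "real (card ({..<r} \<inter> A)) \<le> sqrt (real (n j)) * sqrt (real (n j))" by simp
    also have "\<dots> \<le> sqrt (real (n j)) * sqrt (real (n k))"
      using True n by (intro mult_left_mono) (auto simp: gap_sequence_def strict_mono_less_eq)
    finally show ?thesis .
  next
    case False
    have "card ({..<r} \<inter> A) \<le> r" by (metis card_lessThan card_mono finite_lessThan Int_lower1)
    moreover have "real r \<le> sqrt (real (n k * n (Suc k)))"
      using r by (intro real_le_rsqrt) (metis of_nat_le_iff of_nat_power)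
    moreover have "\<dots> \<le> sqrt (real (n k * n j))"
      using False n by (intro real_sqrt_le_mono) (auto simp: gap_sequence_def strict_mono_less_eq)
    ultimately show ?thesis by (simp add: real_sqrt_mult mult.commute)
  qed
  hence "c * real (card ({..<r} \<inter> A)) \<le> c * (sqrt (real (n j)) * sqrt (real (n k)))"
    using x(3) by (rule mult_left_mono)
  with 1 have "norm (\<Sum>i<r. x i) \<le> c * sqrt (real (n j)) * sqrt (real (n k))" by (simp add: mult.assoc)
  thus ?thesis using pos[of k] j by (simp add: divide_le_eq)
qed

locale partial_sum_space =
  fixes n :: "nat \<Rightarrow> nat"
    and \<phi> :: "(nat \<Rightarrow> 'k::{real_normed_field,banach,second_countable_topology}) \<Rightarrow> 'v"
  assumes n: "gap_sequence n" and inj: "inj \<phi>"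
begin

sublocale coordinate_space "partial_sum_seminorms n" \<phi>
proof -
  show "coordinate_space (partial_sum_seminorms n) \<phi>"
    using n inj
    by (intro coordinate_space.intro coordinate_space_axioms.intro coordinate_seminorms_partial_sums)
      (auto simp: gap_sequence_def)
qed

abbreviation "coeffs_on A a \<equiv> (\<lambda>i. if i \<in> A then a i else 0 :: 'k)"

lemma coeffs_on_in_seqs:
  assumes "finite A"
  shows "coeffs_on A a \<in> seqs"
proof -
  have "A \<subseteq> {..<Suc (Max A)}" using assms by (auto simp: less_Suc_eq_le)
  hence "initial_part (Suc (Max A)) (coeffs_on A a) = coeffs_on A a" by (intro initial_part_eq_self) auto
  thus ?thesis using initial_part_in_seqs[of "Suc (Max A)" "coeffs_on A a"] by simp
qed

lemma le_vnorm_sum: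
  assumes "finite A" "\<And>i. i \<in> A \<Longrightarrow> c \<le> norm (a i)" "0 \<le> c"
  shows "c * sqrt (real (card A)) \<le> vnorm seq_space (\<Oplus>\<^bsub>seq_space\<^esub>i\<in>A. a i \<odot>\<^bsub>seq_space\<^esub> basis i)"
proof -
  obtain N where "c * sqrt (real (card A)) \<le> L2_set (\<lambda>i. norm (coeffs_on A a i)) {..<N}"
    using le_L2_set_of_bounded[of A c "coeffs_on A a"] assms by auto
  also have "\<dots> \<le> sup_norm (coeffs_on A a)"
    using le_sup_norm[OF coeffs_on_in_seqs[OF assms(1)] L2_set_in_partial_sum_seminorms] .
  finally show ?thesis by (simp only: finsum_basis[OF assms(1)] seq_space_simps)
qed

lemma vnorm_sum_le:
  assumes "finite A" "\<And>i. i \<in> A \<Longrightarrow> norm (a i) \<le> c" "0 \<le> c"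
    and partial: "\<And>k r. r\<^sup>2 \<le> n k * n (Suc k) \<Longrightarrow>
      norm (\<Sum>i<r. coeffs_on A a i) / sqrt (real (n k)) \<le> c * sqrt (real (card A))"
  shows "vnorm seq_space (\<Oplus>\<^bsub>seq_space\<^esub>i\<in>A. a i \<odot>\<^bsub>seq_space\<^esub> basis i) \<le> c * sqrt (real (card A))"
proof -
  have "sup_norm (coeffs_on A a) \<le> c * sqrt (real (card A))"
  proof (rule sup_norm_le)
    fix q :: "(nat \<Rightarrow> 'k) \<Rightarrow> real" assume "q \<in> partial_sum_seminorms n"
    thus "q (coeffs_on A a) \<le> c * sqrt (real (card A))"
    proof (cases rule: partial_sum_seminormsE)
      case (1 N)
      show ?thesis unfolding 1 using assms(1-3) by (intro L2_set_le_of_bounded) auto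
    next
      case (2 k r)
      show ?thesis unfolding 2(2) using 2(1) by (rule partial)
    qed
  qed
  thus ?thesis by (simp only: finsum_basis[OF assms(1)] seq_space_simps)
qed

lemma indicator_sum_eq:
  "indicator_sum seq_space basis A = (\<Oplus>\<^bsub>seq_space\<^esub>i\<in>A. 1 \<odot>\<^bsub>seq_space\<^esub> basis i)"
proof -
  have "1 \<odot>\<^bsub>seq_space\<^esub> basis i = basis i" for i by (simp add: basis_def seq_space_simps scale_seq_simps)
  thus ?thesis by (simp add: indicator_sum_def)
qed

text \<open>
  By the \<open>\<ell>\<^sub>2\<close> norm from below and \<open>partial_sum_le\<close> from above, the norm of \<open>\<Sum>\<^sub>A a\<^sub>i e\<^sub>i\<close> lies between \<open>min |a\<^sub>i| \<surd>|A|\<close> and \<open>max |a\<^sub>i| \<surd>|A|\<close>; in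
  particular \<open>\<Sum>\<^sub>A e\<^sub>i\<close> has norm \<open>\<surd>|A|\<close>.
\<close>

lemma UL_property_range: "UL_property (range n) seq_space basis"
proof -
  have main: "1 / 1 * Min ((\<lambda>i. norm (a i)) ` A) * vnorm seq_space (indicator_sum seq_space basis A)
             \<le> vnorm seq_space (\<Oplus>\<^bsub>seq_space\<^esub>i\<in>A. a i \<odot>\<^bsub>seq_space\<^esub> basis i) \<and>
           vnorm seq_space (\<Oplus>\<^bsub>seq_space\<^esub>i\<in>A. a i \<odot>\<^bsub>seq_space\<^esub> basis i)
             \<le> 1 * Max ((\<lambda>i. norm (a i)) ` A) * vnorm seq_space (indicator_sum seq_space basis A)"
    if A: "finite A" "card A \<in> range n" for A and a :: "nat \<Rightarrow> 'k"
  proof -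
    have ne: "A \<noteq> {}" using A(2) n unfolding gap_sequence_def by (metis card.empty imageE less_irrefl)
    have le: "vnorm seq_space (\<Oplus>\<^bsub>seq_space\<^esub>i\<in>A. b i \<odot>\<^bsub>seq_space\<^esub> basis i) \<le> c * sqrt (real (card A))"
      if b: "\<And>i. i \<in> A \<Longrightarrow> norm (b i) \<le> c" "0 \<le> c" for b c
    proof (rule vnorm_sum_le[OF A(1) b])
      fix k r assume "r\<^sup>2 \<le> n k * n (Suc k)"
      thus "norm (\<Sum>i<r. coeffs_on A b i) / sqrt (real (n k)) \<le> c * sqrt (real (card A))"
        using b by (intro partial_sum_le[OF n A]) auto
    qed
    have one: "vnorm seq_space (indicator_sum seq_space basis A) = sqrt (real (card A))"
      unfolding indicator_sum_eq using le[of "\<lambda>_. 1" 1] le_vnorm_sum[of A 1 "\<lambda>_. 1"] A by simp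
    have "Min ((\<lambda>i. norm (a i)) ` A) * sqrt (real (card A))
        \<le> vnorm seq_space (\<Oplus>\<^bsub>seq_space\<^esub>i\<in>A. a i \<odot>\<^bsub>seq_space\<^esub> basis i)"
      using A ne by (intro le_vnorm_sum) auto
    moreover have "vnorm seq_space (\<Oplus>\<^bsub>seq_space\<^esub>i\<in>A. a i \<odot>\<^bsub>seq_space\<^esub> basis i)
        \<le> Max ((\<lambda>i. norm (a i)) ` A) * sqrt (real (card A))"
      using A ne by (intro le) (auto simp: Max_ge_iff)
    ultimately show ?thesis by (simp add: one)
  qed
  show ?thesis unfolding UL_property_def
    by (intro exI[of _ "1::real"] conjI[OF zero_less_one] allI impI, elim conjE, rule main)
qed

text \<open>
  The first \<open>m\<close> coordinate vectors, \<open>m\<close> being the integer part of \<open>\<surd>(n\<^sub>k n\<^sub>k\<^sub>+\<^sub>1)\<close>, have a sum of norm at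
  least \<open>m / \<surd>n\<^sub>k\<close>, whereas with alternating signs all partial sums stay bounded by one and the norm is
  at most \<open>\<surd>m\<close>.  Unconditionality makes the two comparable, which bounds \<open>m / n\<^sub>k\<close>, hence also \<open>n\<^sub>k\<^sub>+\<^sub>1 / n\<^sub>k\<close>.
\<close>

lemma bounded_gaps_if_unconditional:
  assumes "unconditional_const_coeffs {1..} seq_space basis"
  shows "bounded_quotient_gaps n"
proof -
  have pos: "0 < n k" for k using n by (auto simp: gap_sequence_def)
  obtain C where C: "0 < C" and ucc: "\<And>A \<epsilon> \<epsilon>'. \<lbrakk>finite A; card A \<in> {1..}; \<epsilon> \<in> Psi A; \<epsilon>' \<in> Psi A\<rbrakk> \<Longrightarrow>
      vnorm seq_space (signed_indicator seq_space basis \<epsilon> A) \<le> C * vnorm seq_space (signed_indicator seq_space basis \<epsilon>' A)"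
    using assms unfolding unconditional_const_coeffs_def by blast
  have "real (n (Suc k)) / real (n k) \<le> (C\<^sup>2 + 1)\<^sup>2" for k
  proof -
    define m where "m = floor_sqrt (n k * n (Suc k))"
    have m: "m\<^sup>2 \<le> n k * n (Suc k)" "n k * n (Suc k) < (Suc m)\<^sup>2"
      by (simp_all add: m_def floor_sqrt_power2_le Suc_floor_sqrt_power2_gt)
    have "1 \<le> n k * n (Suc k)" using pos by (simp add: Suc_le_eq)
    hence m1: "1 \<le> m" unfolding m_def by (simp add: le_floor_sqrt_iff)
    define alt where "alt = restrict (\<lambda>i. (- 1) ^ i :: 'k) {..<m}"
    define one where "one = restrict (\<lambda>i. 1 :: 'k) {..<m}"
    have alt_sum: "(\<Sum>i<r. (- 1) ^ i :: 'k) = (if even r then 0 else 1)" for r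
      by (induction r) auto
    have alt: "vnorm seq_space (signed_indicator seq_space basis alt {..<m}) \<le> 1 * sqrt (real (card {..<m}))"
      unfolding signed_indicator_def
    proof (rule vnorm_sum_le)
      fix j r
      have "(\<Sum>i<r. coeffs_on {..<m} alt i) = (\<Sum>i<r. initial_part m (\<lambda>i. (- 1) ^ i) i)"
        by (intro sum.cong) (auto simp: initial_part_def alt_def)
      also have "norm \<dots> \<le> 1" unfolding sum_initial_part alt_sum by simp
      finally have "norm (\<Sum>i<r. coeffs_on {..<m} alt i) / sqrt (real (n j)) \<le> 1 / sqrt (real (n j))"
        by (rule divide_right_mono) simp
      also have "\<dots> \<le> 1" using pos[of j] by simp
      also have "\<dots> \<le> 1 * sqrt (real (card {..<m}))" using m1 by simp
      finally show "norm (\<Sum>i<r. coeffs_on {..<m} alt i) / sqrt (real (n j)) \<le> 1 * sqrt (real (card {..<m}))" .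
    qed (auto simp: alt_def norm_power)
    have "(\<Sum>i<m. coeffs_on {..<m} one i) = (\<Sum>i<m. 1)"
      by (intro sum.cong) (auto simp: one_def)
    hence "real m / sqrt (real (n k)) = norm (\<Sum>i<m. coeffs_on {..<m} one i) / sqrt (real (n k))"
      by (simp only: sum_constant card_lessThan) simp
    also have "\<dots> \<le> sup_norm (coeffs_on {..<m} one)"
      by (rule le_sup_norm[OF coeffs_on_in_seqs[OF finite_lessThan]
          partial_sum_in_partial_sum_seminorms[OF m(1)]])
    also have "\<dots> = vnorm seq_space (signed_indicator seq_space basis one {..<m})"
      unfolding signed_indicator_def by (simp only: finsum_basis finite_lessThan seq_space_simps)
    also have "\<dots> \<le> C * vnorm seq_space (signed_indicator seq_space basis alt {..<m})"
      using m1 by (intro ucc) (auto simp: Psi_def one_def alt_def norm_power)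
    also have "\<dots> \<le> C * sqrt (real m)" using alt C by simp
    finally have "real m \<le> C * sqrt (real m) * sqrt (real (n k))" using pos[of k] by (simp add: field_simps)
    hence "sqrt (real m) * sqrt (real m) \<le> sqrt (real m) * (C * sqrt (real (n k)))" by (simp add: mult_ac)
    hence "sqrt (real m) \<le> C * sqrt (real (n k))" by (rule mult_left_le_imp_le) (use m1 in simp)
    hence "(sqrt (real m))\<^sup>2 \<le> (C * sqrt (real (n k)))\<^sup>2" by (intro power_mono) auto
    hence mk: "real m \<le> C\<^sup>2 * real (n k)" by (simp add: power_mult_distrib)
    have nk1: "1 \<le> real (n k)" using pos[of k] by simp
    have "real (n k) * real (n (Suc k)) \<le> (real m + 1)\<^sup>2"
      using m(2) by (metis less_imp_le of_nat_Suc of_nat_le_iff of_nat_mult of_nat_power add.commute)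
    also have "\<dots> \<le> ((C\<^sup>2 + 1) * real (n k))\<^sup>2"
      using mk nk1 by (intro power_mono) (auto simp: distrib_right)
    also have "\<dots> = real (n k) * ((C\<^sup>2 + 1)\<^sup>2 * real (n k))" by (simp add: power2_eq_square mult_ac)
    finally have "real (n (Suc k)) \<le> (C\<^sup>2 + 1)\<^sup>2 * real (n k)" using pos[of k] by simp
    thus ?thesis using pos[of k] by (simp add: divide_le_eq)
  qed
  \<comment> \<open>Below, the bound is enlarged by two because a quotient bound has to be at least two.\<close>
  moreover obtain l :: nat where l: "(C\<^sup>2 + 1)\<^sup>2 \<le> real l" using real_arch_simple by blast
  ultimately show ?thesis
    unfolding bounded_quotient_gaps_def
    by (intro exI[of _ "l + 2"]) (force intro: order_trans)
qed

end

section \<open>Copies of sequence spaces in a large type\<close>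

text \<open>
  A point is determined by the members of a countable topological basis that contain it.
\<close>

lemma second_countable_lepoll_nat_sets:
  "(UNIV :: 'k::{second_countable_topology,t2_space} set) \<lesssim> (UNIV :: nat set set)"
proof -
  obtain B :: "'k set set" where B: "countable B" "topological_basis B"
    using ex_countable_basis by blast
  define f where "f x = to_nat_on B ` {U \<in> B. x \<in> U}" for x
  have "inj f"
  proof
    fix x y assume eq: "f x = f y"
    show "x = y"
    proof (rule ccontr)
      assume "x \<noteq> y"
      then obtain U where U: "open U" "x \<in> U" "y \<notin> U" using separation_t1 by blast
      then obtain W where W: "W \<in> B" "x \<in> W" "W \<subseteq> U"
        using topological_basisE[OF B(2)] by blast
      hence "to_nat_on B W \<in> f y" using eq by (auto simp: f_def)
      then obtain W' where "W' \<in> B" "y \<in> W'" "to_nat_on B W = to_nat_on B W'" by (auto simp: f_def)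
      hence "y \<in> W" using inj_on_to_nat_on[OF B(1)] W by (metis inj_onD)
      thus False using W U by auto
    qed
  qed
  thus ?thesis unfolding lepoll_def by auto
qed

text \<open>
  A sequence of scalars becomes a sequence of sets of naturals, that is, one set of pairs of naturals.
\<close>

lemma ex_inj_sequences:
  assumes "large_type TYPE('v)"
  shows "\<exists>\<phi> :: (nat \<Rightarrow> 'k::{second_countable_topology,t2_space}) \<Rightarrow> 'v. inj \<phi>"
proof -
  obtain g :: "'k \<Rightarrow> nat set" where g: "inj g"
    using second_countable_lepoll_nat_sets unfolding lepoll_def by auto
  define h where "h x = prod_encode ` (SIGMA i:UNIV. g (x i))" for x :: "nat \<Rightarrow> 'k"
  have "inj h"
  proof
    fix x y assume "h x = h y"
    hence "(SIGMA i:UNIV. g (x i)) = (SIGMA i:UNIV. g (y i))"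
      unfolding h_def by (simp add: inj_image_eq_iff inj_prod_encode)
    hence "g (x i) = g (y i)" for i by auto
    thus "x = y" by (intro ext injD[OF g])
  qed
  moreover have "(UNIV :: nat set set) \<lesssim> (UNIV :: 'v set)"
    using lepoll_trans1[OF nat_sets_eqpoll_reals] assms unfolding large_type_def by blast
  then obtain r :: "nat set \<Rightarrow> 'v" where "inj r" unfolding lepoll_def by blast
  ultimately have "inj (r \<circ> h)" by (intro inj_compose)
  thus ?thesis by (rule exI[of _ "r \<circ> h"])
qed

section \<open>The equivalence\<close>

text \<open>
  The real and the complex case are the same statement about a separable complete normed field.
\<close>

lemma bounded_quotient_gaps_iff:
  assumes n: "gap_sequence n" and large: "large_type TYPE('v)"
  shows "bounded_quotient_gaps n \<longleftrightarrow>
       (\<forall>(V :: ('k::{real_normed_field,banach,second_countable_topology}, 'v) normed_module) e. banach_space V \<and> schauder_basis V e \<and>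
          unconditional_const_coeffs (range n) V e \<longrightarrow> unconditional_const_coeffs {1..} V e)" (is "?B \<longleftrightarrow> ?U")
    and "bounded_quotient_gaps n \<longleftrightarrow>
       (\<forall>(V :: ('k, 'v) normed_module) e. banach_space V \<and> schauder_basis V e \<and>
          UL_property (range n) V e \<longrightarrow> UL_property {1..} V e)" (is "_ \<longleftrightarrow> ?UL")
proof -
  obtain \<phi> :: "(nat \<Rightarrow> 'k) \<Rightarrow> 'v" where "inj \<phi>" using ex_inj_sequences[OF large] by blast
  then interpret partial_sum_space n \<phi> using n by (intro partial_sum_space.intro)
  have n0: "0 \<notin> range n" using n unfolding gap_sequence_def by (metis imageE less_irrefl)
  show "?B \<longleftrightarrow> ?U"
  proof
    assume ?B
    show ?U
      by (intro allI impI, elim conjE,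
          rule unconditional_const_coeffs_if_bounded_gaps[OF banach_space.axioms(1) _ n \<open>?B\<close>])
  next
    assume ?U
    hence "unconditional_const_coeffs {1..} seq_space basis"
      using banach_space schauder_basis UL_imp_unconditional[OF UL_property_range n0] by blast
    thus ?B by (rule bounded_gaps_if_unconditional)
  qed
  show "?B \<longleftrightarrow> ?UL"
  proof
    assume ?B
    show ?UL
      by (intro allI impI, elim conjE,
          rule UL_property_if_bounded_gaps[OF banach_space.axioms(1) _ n \<open>?B\<close>])
  next
    assume ?UL
    hence "UL_property {1..} seq_space basis"
      using banach_space schauder_basis UL_property_range by blast
    hence "unconditional_const_coeffs {1..} seq_space basis"
      by (rule UL_imp_unconditional) auto
    thus ?B by (rule bounded_gaps_if_unconditional)
  qed
qed

theorem corollary2p6: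
  fixes n :: "nat \<Rightarrow> nat"
  assumes "gap_sequence n"
    and "large_type TYPE('v)"
  shows
    "(bounded_quotient_gaps n \<longleftrightarrow>
       (\<forall>(V :: (real, 'v) normed_module) e. banach_space V \<and> schauder_basis V e \<and>
          unconditional_const_coeffs (range n) V e \<longrightarrow> unconditional_const_coeffs {1..} V e)) \<and>
     (bounded_quotient_gaps n \<longleftrightarrow>
       (\<forall>(V :: (real, 'v) normed_module) e. banach_space V \<and> schauder_basis V e \<and>
          UL_property (range n) V e \<longrightarrow> UL_property {1..} V e)) \<and>
     (bounded_quotient_gaps n \<longleftrightarrow>
       (\<forall>(V :: (complex, 'v) normed_module) e. banach_space V \<and> schauder_basis V e \<and>
          unconditional_const_coeffs (range n) V e \<longrightarrow> unconditional_const_coeffs {1..} V e)) \<and>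
     (bounded_quotient_gaps n \<longleftrightarrow>
       (\<forall>(V :: (complex, 'v) normed_module) e. banach_space V \<and> schauder_basis V e \<and>
          UL_property (range n) V e \<longrightarrow> UL_property {1..} V e))"
  by (intro conjI bounded_quotient_gaps_iff[OF assms])

end
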